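(* Let $\gamma>0$, let $u^*$ be the solution of the variational inequality (VI) described in the context, and let $X,Y$ be sets satisfying the assumptions (a)–(c) of the context. Let $G_\gamma\colon V\to\mathbb{R}$, $$G_\gamma(u)=\sup_{v\in K\cap Y}\Big(\langle Au-f,u-v\rangle-\frac{1}{2\gamma}\|u-v\|_V^2\Big).$$ Then: (i) $G_\gamma$ is finite everywhere on $V$; (ii) $G_\gamma(u)\ge 0$ for all $u\in K\cap X$; (iii) $u\in K\cap X$ satisfies $G_\gamma(u)=0$ if and only if $u$ solves (VI); (iv) $G_\gamma\colon K\cap X\subset V\to\mathbb{R}$ is lower semicontinuous (with respect to the $V$-norm).
   Context: $\Omega\subset\mathbb{R}^n$ is a bounded Lipschitz domain, $V:=H^1(\Omega)$ with its usual norm $\|\cdot\|_V$, $V^*$ its dual, $\langle\cdot,\cdot\rangle$ the duality pairing between $V^*$ and $V$. Data: $f\in L^2(\Omega)$, $h\in H^{1/2}(\partial\Omega)$, $\psi\in H^1(\Omega)$ with $\psi\le h$ on $\partial\Omega$ (in the trace sense), and $$K:=\{u\in H^1(\Omega): u\ge\psi \text{ in }\Omega,\ u=h\text{ on }\partial\Omega\}.$$ $A$ is the linear operator $V\to V^*$, $\langle Au,w\rangle=\int_\Omega\nabla u\cdot\nabla w+\sum_{i=1}^n b_i\,\partial_{x_i}u\,w+k\,u\,w$, with constants $b_i,k\ge0$ such that there are $C_a,C_b>0$ with $\|Au-Av\|_{V^*}\le C_b\|u-v\|_V$ and $\langle Au-Av,u-v\rangle\ge C_a\|u-v\|_V^2$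 for all $u,v\in K$. (VI): find $u\in K$ with $\langle Au-f,u-v\rangle\le0$ for all $v\in K$. It has a unique solution, denoted $u^*$. Assumptions on the sets $X,Y$: (a) $u^*\in X\cap Y$; (b) $K\cap X\subset K\cap Y$; (c) $K\cap Y$ is convex and closed (in $V$). *)

theory Defs
  imports "HOL-Analysis.Analysis"
begin

section \<open>The Hilbert space of square-integrable functions modulo a.e. equality\<close>

definition sq_integrable :: "('a::euclidean_space \<Rightarrow> real) \<Rightarrow> bool" where
  "sq_integrable f \<longleftrightarrow> f \<in> borel_measurable lebesgue \<and> integrable lebesgue (\<lambda>x. (f x)\<^sup>2)"

definition l2_rel :: "('a::euclidean_space \<Rightarrow> real) \<Rightarrow> ('a \<Rightarrow> real) \<Rightarrow> bool" where
  "l2_rel f g \<longleftrightarrow> sq_integrable f \<and> sq_integrable g \<and> (AE x in lebesgue. f x = g x)"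

lemma sq_integrable_zero: "sq_integrable (\<lambda>x. 0)"
  by (simp add: sq_integrable_def)

lemma sq_integrable_mult:
  assumes "sq_integrable f" "sq_integrable g"
  shows "integrable lebesgue (\<lambda>x. f x * g x)"
proof (rule Bochner_Integration.integrable_bound)
  show "integrable lebesgue (\<lambda>x. (f x)\<^sup>2 + (g x)\<^sup>2)"
    using assms by (auto simp: sq_integrable_def)
  show "(\<lambda>x. f x * g x) \<in> borel_measurable lebesgue"
    using assms by (auto simp: sq_integrable_def)
  have "\<bar>a * b\<bar> \<le> a\<^sup>2 + b\<^sup>2" for a b :: real
  proof -
    have "2 * (\<bar>a\<bar> * \<bar>b\<bar>) \<le> \<bar>a\<bar>\<^sup>2 + \<bar>b\<bar>\<^sup>2"
      using sum_squares_bound[of "\<bar>a\<bar>" "\<bar>b\<bar>"] by simp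
    moreover have "0 \<le> \<bar>a\<bar> * \<bar>b\<bar>" by simp
    ultimately show ?thesis by (simp only: abs_mult power2_abs)
  qed
  then show "AE x in lebesgue. norm (f x * g x) \<le> norm ((f x)\<^sup>2 + (g x)\<^sup>2)"
    by auto
qed

lemma sq_integrable_add:
  assumes "sq_integrable f" "sq_integrable g"
  shows "sq_integrable (\<lambda>x. f x + g x)"
proof -
  have "integrable lebesgue (\<lambda>x. (f x)\<^sup>2 + (g x)\<^sup>2 + 2 * (f x * g x))"
    using assms sq_integrable_mult[OF assms] by (auto simp: sq_integrable_def)
  moreover have "(f x)\<^sup>2 + (g x)\<^sup>2 + 2 * (f x * g x) = (f x + g x)\<^sup>2" for x
    by (simp add: power2_sum)
  moreover have "(\<lambda>x. f x + g x) \<in> borel_measurable lebesgue"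
    using assms by (auto simp: sq_integrable_def intro: borel_measurable_add)
  ultimately show ?thesis by (simp add: sq_integrable_def)
qed

lemma sq_integrable_scale: "sq_integrable f \<Longrightarrow> sq_integrable (\<lambda>x. c * f x)"
  by (auto simp: sq_integrable_def power_mult_distrib)

lemma sq_integrable_minus: "sq_integrable f \<Longrightarrow> sq_integrable (\<lambda>x. - f x)"
  by (auto simp: sq_integrable_def)

lemma sq_integrable_diff:
  "sq_integrable f \<Longrightarrow> sq_integrable g \<Longrightarrow> sq_integrable (\<lambda>x. f x - g x)"
  using sq_integrable_add[of f "\<lambda>x. - g x"] sq_integrable_minus[of g] by simp

lemma l2_rel_trans:
  assumes "l2_rel f g" "l2_rel g h"
  shows "l2_rel f h"
proof -
  have "AE x in lebesgue. f x = g x" "AE x in lebesgue. g x = h x"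
    using assms by (auto simp: l2_rel_def)
  then have "AE x in lebesgue. f x = h x" by eventually_elim simp
  then show ?thesis using assms by (simp add: l2_rel_def)
qed

quotient_type (overloaded) 'a l2 = "'a::euclidean_space \<Rightarrow> real" / partial: l2_rel
proof (rule part_equivpI)
  show "\<exists>f. l2_rel f f"
    using sq_integrable_zero by (auto simp: l2_rel_def)
  show "symp l2_rel"
    by (auto simp: symp_def l2_rel_def)
  show "transp l2_rel"
    using l2_rel_trans by (rule transpI)
qed

instantiation l2 :: (euclidean_space) real_inner
begin

lift_definition zero_l2 :: "'a l2" is "\<lambda>x. 0"
  by (simp add: l2_rel_def sq_integrable_zero)

lift_definition plus_l2 :: "'a l2 \<Rightarrow> 'a l2 \<Rightarrow> 'a l2" is "\<lambda>f g x. f x + g x"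
  by (auto simp: l2_rel_def sq_integrable_add)

lift_definition minus_l2 :: "'a l2 \<Rightarrow> 'a l2 \<Rightarrow> 'a l2" is "\<lambda>f g x. f x - g x"
  by (auto simp: l2_rel_def sq_integrable_diff)

lift_definition uminus_l2 :: "'a l2 \<Rightarrow> 'a l2" is "\<lambda>f x. - f x"
  by (auto simp: l2_rel_def sq_integrable_minus)

lift_definition scaleR_l2 :: "real \<Rightarrow> 'a l2 \<Rightarrow> 'a l2" is "\<lambda>c f x. c * f x"
  by (auto simp: l2_rel_def sq_integrable_scale)

lift_definition inner_l2 :: "'a l2 \<Rightarrow> 'a l2 \<Rightarrow> real" is "\<lambda>f g. LINT x|lebesgue. f x * g x"
  by (rule integral_cong_AE) (auto simp: l2_rel_def sq_integrable_def)

definition norm_l2 :: "'a l2 \<Rightarrow> real" where "norm_l2 u = sqrt (u \<bullet> u)"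
definition sgn_l2 :: "'a l2 \<Rightarrow> 'a l2" where "sgn_l2 u = inverse (norm u) *\<^sub>R u"
definition dist_l2 :: "'a l2 \<Rightarrow> 'a l2 \<Rightarrow> real" where "dist_l2 u v = norm (u - v)"
definition uniformity_l2 :: "('a l2 \<times> 'a l2) filter" where
  "uniformity_l2 = (INF e\<in>{0<..}. principal {(u, v). dist u v < e})"
definition open_l2 :: "'a l2 set \<Rightarrow> bool" where
  "open_l2 U \<longleftrightarrow> (\<forall>u\<in>U. \<forall>\<^sub>F (u', v) in uniformity. u' = u \<longrightarrow> v \<in> U)"

instance
proof
  fix u v w :: "'a l2" and a b c :: real
  show "u + v + w = u + (v + w)"
    by transfer (auto simp: l2_rel_def add.assoc intro!: sq_integrable_add)
  show "u + v = v + u"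
    by transfer (auto simp: l2_rel_def add.commute intro!: sq_integrable_add)
  show "0 + u = u"
    by transfer (auto simp: l2_rel_def)
  show "- u + u = 0"
    by transfer (auto simp: l2_rel_def sq_integrable_zero)
  show "u - v = u + - v"
    by transfer (auto simp: l2_rel_def intro!: sq_integrable_diff)
  show "a *\<^sub>R (u + v) = a *\<^sub>R u + a *\<^sub>R v"
    by transfer (auto simp: l2_rel_def distrib_left intro!: sq_integrable_add sq_integrable_scale)
  show "(a + b) *\<^sub>R u = a *\<^sub>R u + b *\<^sub>R u"
    by transfer (auto simp: l2_rel_def distrib_right intro!: sq_integrable_add sq_integrable_scale)
  show "a *\<^sub>R b *\<^sub>R u = (a * b) *\<^sub>R u"
    by transfer (auto simp: l2_rel_def mult.assoc intro!: sq_integrable_scale)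
  show "1 *\<^sub>R u = u"
    by transfer (auto simp: l2_rel_def)
  show "u \<bullet> v = v \<bullet> u"
    by transfer (simp add: mult.commute)
  show "(u + v) \<bullet> w = u \<bullet> w + v \<bullet> w"
    by transfer (simp add: l2_rel_def distrib_right sq_integrable_mult)
  show "(a *\<^sub>R u) \<bullet> v = a * (u \<bullet> v)"
    by transfer (simp add: mult.assoc)
  show "0 \<le> u \<bullet> u"
    by transfer (simp add: Bochner_Integration.integral_nonneg)
  show "u \<bullet> u = 0 \<longleftrightarrow> u = 0"
  proof transfer
    fix f :: "'a \<Rightarrow> real" assume "l2_rel f f"
    then have f: "sq_integrable f" by (simp add: l2_rel_def)
    have "(LINT x|lebesgue. f x * f x) = 0 \<longleftrightarrow> (AE x in lebesgue. f x * f x = 0)"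
      by (rule integral_nonneg_eq_0_iff_AE[OF sq_integrable_mult[OF f f]]) simp
    also have "\<dots> \<longleftrightarrow> l2_rel f (\<lambda>x. 0)"
      using f by (simp add: l2_rel_def sq_integrable_zero)
    finally show "(LINT x|lebesgue. f x * f x) = 0 \<longleftrightarrow> l2_rel f (\<lambda>x. 0)" .
  qed
qed (rule norm_l2_def sgn_l2_def dist_l2_def uniformity_l2_def open_l2_def)+

end


section \<open>Bounded Lipschitz domains and surface measure\<close>

text \<open>Near every boundary point, \<open>\<Omega>\<close> is the part strictly above the graph of a
  Lipschitz function in the direction of a unit vector \<open>e\<close>; the function only depends on the
  orthogonal projection to the hyperplane perpendicular to \<open>e\<close>.\<close>

definition bounded_lipschitz_domain :: "'a::euclidean_space set \<Rightarrow> bool" where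
  "bounded_lipschitz_domain \<Omega> \<longleftrightarrow>
     open \<Omega> \<and> connected \<Omega> \<and> \<Omega> \<noteq> {} \<and> bounded \<Omega> \<and>
     (\<forall>x\<in>frontier \<Omega>. \<exists>U e L \<phi>. open U \<and> x \<in> U \<and> norm e = 1 \<and> L-lipschitz_on UNIV (\<phi> :: 'a \<Rightarrow> real) \<and>
        \<Omega> \<inter> U = {y \<in> U. \<phi> (y - (y \<bullet> e) *\<^sub>R e) < y \<bullet> e})"

definition hausdorff_pre :: "nat \<Rightarrow> real \<Rightarrow> 'a::metric_space set \<Rightarrow> ennreal" where
  "hausdorff_pre s \<delta> A =
     (INF C \<in> {C :: nat \<Rightarrow> 'a set. A \<subseteq> (\<Union>j. C j) \<and> (\<forall>j. bounded (C j) \<and> diameter (C j) \<le> \<delta>)}.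
        \<Sum>j. if C j = {} then 0
             else ennreal (unit_ball_vol (real s) * (diameter (C j) / 2) ^ s))"

definition hausdorff_outer :: "nat \<Rightarrow> 'a::metric_space set \<Rightarrow> ennreal" where
  "hausdorff_outer s A = (SUP \<delta>\<in>{0<..}. hausdorff_pre s \<delta> A)"

text \<open>The outer measure restricted to its Caratheodory-measurable sets.\<close>

definition hausdorff_measure :: "nat \<Rightarrow> 'a::metric_space measure" where
  "hausdorff_measure s =
     measure_of UNIV (lambda_system UNIV UNIV (hausdorff_outer s)) (hausdorff_outer s)"

lemma hausdorff_pre_subadditive:
  fixes A :: "nat \<Rightarrow> 'a::metric_space set"
  shows "hausdorff_pre s \<delta> (\<Union>i. A i) \<le> (\<Sum>i. hausdorff_pre s \<delta> (A i))"
proof (rule ennreal_le_epsilon)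
  fix e :: real assume "0 < e" and fin: "(\<Sum>i. hausdorff_pre s \<delta> (A i)) < top"
  define cov where
    "cov A = {C :: nat \<Rightarrow> 'a set. A \<subseteq> (\<Union>j. C j) \<and> (\<forall>j. bounded (C j) \<and> diameter (C j) \<le> \<delta>)}" for A
  define w where
    "w D = (if D = {} then 0 else ennreal (unit_ball_vol (real s) * (diameter D / 2) ^ s))"
    for D :: "'a set"
  have pre: "hausdorff_pre s \<delta> A = (INF C\<in>cov A. \<Sum>j. w (C j))" for A
    by (simp add: hausdorff_pre_def cov_def w_def)
  define \<epsilon> where "\<epsilon> i = ennreal (e * (1/2) ^ Suc i)" for i
  have eps: "0 < \<epsilon> i" for i using \<open>0 < e\<close> by (simp add: \<epsilon>_def)
  have "\<exists>C. C \<in> cov (A i) \<and> (\<Sum>j. w (C j)) < hausdorff_pre s \<delta> (A i) + \<epsilon> i" for i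
  proof -
    have "hausdorff_pre s \<delta> (A i) < top"
      using fin by (rule ennreal_suminf_lessD)
    then have "hausdorff_pre s \<delta> (A i) < hausdorff_pre s \<delta> (A i) + \<epsilon> i"
      using eps[of i] ennreal_add_left_cancel_less[of "hausdorff_pre s \<delta> (A i)" 0 "\<epsilon> i"]
      by (simp only: add_0_right less_top infinity_ennreal_def simp_thms)
    then have "(INF C\<in>cov (A i). \<Sum>j. w (C j)) < hausdorff_pre s \<delta> (A i) + \<epsilon> i"
      by (simp only: pre)
    then show ?thesis
      unfolding INF_less_iff by blast
  qed
  then obtain C where C: "\<And>i. C i \<in> cov (A i)"
    and Cw: "\<And>i. (\<Sum>j. w (C i j)) < hausdorff_pre s \<delta> (A i) + \<epsilon> i"
    by metis
  define D where "D m = (case prod_decode m of (i, j) \<Rightarrow> C i j)" for m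
  have "D \<in> cov (\<Union>i. A i)"
    unfolding cov_def
  proof (intro CollectI conjI subsetI allI)
    fix x assume "x \<in> (\<Union>i. A i)"
    then obtain i where "x \<in> A i" by blast
    then obtain j where "x \<in> C i j" using C[of i] by (auto simp: cov_def)
    then have "x \<in> D (prod_encode (i, j))" by (simp add: D_def)
    then show "x \<in> (\<Union>m. D m)" by blast
  next
    fix m
    obtain i j where "prod_decode m = (i, j)" by fastforce
    then show "bounded (D m)" "diameter (D m) \<le> \<delta>"
      using C[of i] by (auto simp: D_def cov_def)
  qed
  then have "hausdorff_pre s \<delta> (\<Union>i. A i) \<le> (\<Sum>m. w (D m))"
    unfolding pre by (rule INF_lower)
  also have "\<dots> = (\<Sum>i. \<Sum>j. w (C i j))"
  proof -
    have "w (D m) = (\<lambda>(i, j). w (C i j)) (prod_decode m)" for m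
      by (simp add: D_def split: prod.split)
    then show ?thesis
      using suminf_ennreal_2dimen[of "\<lambda>i. \<Sum>j. w (C i j)" "\<lambda>(i, j). w (C i j)"] by simp
  qed
  also have "\<dots> \<le> (\<Sum>i. hausdorff_pre s \<delta> (A i) + \<epsilon> i)"
    using Cw by (intro suminf_le) (auto intro: less_imp_le)
  also have "\<dots> = (\<Sum>i. hausdorff_pre s \<delta> (A i)) + (\<Sum>i. \<epsilon> i)"
    by (rule suminf_add[symmetric]) auto
  also have "(\<Sum>i. \<epsilon> i) = ennreal e"
    unfolding \<epsilon>_def using \<open>0 < e\<close>
    by (intro suminf_ennreal_eq) (use sums_mult[OF power_half_series, of e] in auto)
  finally show "hausdorff_pre s \<delta> (\<Union>i. A i) \<le> (\<Sum>i. hausdorff_pre s \<delta> (A i)) + ennreal e" .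
qed

lemma outer_measure_space_hausdorff_outer:
  "outer_measure_space UNIV (hausdorff_outer s :: 'a::metric_space set \<Rightarrow> ennreal)"
  unfolding outer_measure_space_def
proof (intro conjI)
  have "hausdorff_pre s \<delta> ({} :: 'a set) = 0" if "0 < \<delta>" for \<delta>
  proof -
    have "hausdorff_pre s \<delta> ({} :: 'a set) \<le> (\<Sum>j. 0)"
      unfolding hausdorff_pre_def by (rule INF_lower2[where i="\<lambda>_. {}"]) (use that in auto)
    then show ?thesis by simp
  qed
  then have "hausdorff_outer s ({} :: 'a set) \<le> 0"
    unfolding hausdorff_outer_def by (intro SUP_least) simp
  then show "positive UNIV (hausdorff_outer s :: 'a set \<Rightarrow> ennreal)"
    by (simp add: positive_def)
  show "increasing UNIV (hausdorff_outer s)"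
    unfolding increasing_def hausdorff_outer_def hausdorff_pre_def
    by (intro ballI impI SUP_mono' INF_superset_mono) auto
  show "countably_subadditive UNIV (hausdorff_outer s :: 'a set \<Rightarrow> ennreal)"
    unfolding countably_subadditive_def
  proof (intro allI impI)
    fix A :: "nat \<Rightarrow> 'a set"
    have "hausdorff_pre s \<delta> (\<Union>i. A i) \<le> (\<Sum>i. hausdorff_outer s (A i))" if "0 < \<delta>" for \<delta>
    proof -
      have "hausdorff_pre s \<delta> (\<Union>i. A i) \<le> (\<Sum>i. hausdorff_pre s \<delta> (A i))"
        by (rule hausdorff_pre_subadditive)
      also have "\<dots> \<le> (\<Sum>i. hausdorff_outer s (A i))"
        unfolding hausdorff_outer_def using that by (intro suminf_le SUP_upper) auto
      finally show ?thesis .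
    qed
    then show "hausdorff_outer s (\<Union>i. A i) \<le> (\<Sum>i. hausdorff_outer s (A i))"
      by (subst hausdorff_outer_def) (auto intro: SUP_least)
  qed
qed

lemma measure_space_hausdorff:
  "measure_space UNIV (lambda_system UNIV UNIV (hausdorff_outer s))
     (hausdorff_outer s :: 'a::metric_space set \<Rightarrow> ennreal)"
proof -
  interpret sigma_algebra UNIV "UNIV :: 'a set set"
    using sigma_algebra_Pow[of "UNIV :: 'a set"] by simp
  show ?thesis by (rule caratheodory_lemma[OF outer_measure_space_hausdorff_outer])
qed

lemma sets_hausdorff_measure:
  "sets (hausdorff_measure s) = lambda_system UNIV UNIV (hausdorff_outer s)"
  unfolding hausdorff_measure_def
  using measure_space_hausdorff[of s]
  by (metis measure_space_def sigma_algebra.sets_measure_of_eq)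

lemma emeasure_hausdorff_measure:
  "A \<in> sets (hausdorff_measure s) \<Longrightarrow> emeasure (hausdorff_measure s) A = hausdorff_outer s A"
  using measure_space_hausdorff[of s] unfolding sets_hausdorff_measure
  unfolding hausdorff_measure_def
  by (intro emeasure_measure_of_sigma) (auto simp: measure_space_def)

definition surface_measure :: "(real^'n) set \<Rightarrow> (real^'n) measure" where
  "surface_measure \<Omega> = restrict_space (hausdorff_measure (CARD('n) - 1)) (frontier \<Omega>)"


section \<open>The Sobolev space \<open>H\<^sup>1(\<Omega>)\<close> and traces\<close>

text \<open>\<open>L\<^sup>2(\<Omega>)\<close> is embedded into the square-integrable functions on the whole space by
  extension by zero, so that membership, equality, norm and inner product only depend on the
  values in \<open>\<Omega>\<close>.\<close>

definition L2_space :: "'a::euclidean_space set \<Rightarrow> 'a l2 set" where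
  "L2_space \<Omega> = {u. AE x in lebesgue. x \<notin> \<Omega> \<longrightarrow> rep_l2 u x = 0}"

definition l2_restrict :: "'a::euclidean_space set \<Rightarrow> ('a \<Rightarrow> real) \<Rightarrow> 'a l2" where
  "l2_restrict \<Omega> \<phi> = abs_l2 (\<lambda>x. indicator \<Omega> x * \<phi> x)"

abbreviation partial :: "'n \<Rightarrow> (real^'n \<Rightarrow> real) \<Rightarrow> real^'n \<Rightarrow> real" where
  "partial i \<phi> x \<equiv> frechet_derivative \<phi> (at x) (axis i 1)"

primrec C_diff :: "nat \<Rightarrow> (real^'n \<Rightarrow> real) \<Rightarrow> bool" where
  "C_diff 0 \<phi> \<longleftrightarrow> continuous_on UNIV \<phi>"
| "C_diff (Suc m) \<phi> \<longleftrightarrow> \<phi> differentiable_on UNIV \<and> (\<forall>i. C_diff m (partial i \<phi>))"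

definition smooth :: "(real^'n \<Rightarrow> real) \<Rightarrow> bool" where
  "smooth \<phi> \<longleftrightarrow> (\<forall>m. C_diff m \<phi>)"

definition test_function :: "(real^'n) set \<Rightarrow> (real^'n \<Rightarrow> real) \<Rightarrow> bool" where
  "test_function \<Omega> \<phi> \<longleftrightarrow>
     smooth \<phi> \<and> compact (closure {x. \<phi> x \<noteq> 0}) \<and> closure {x. \<phi> x \<noteq> 0} \<subseteq> \<Omega>"

definition has_weak_partial :: "(real^'n) set \<Rightarrow> 'n \<Rightarrow> (real^'n) l2 \<Rightarrow> (real^'n) l2 \<Rightarrow> bool" where
  "has_weak_partial \<Omega> i u w \<longleftrightarrow> w \<in> L2_space \<Omega> \<and>
     (\<forall>\<phi>. test_function \<Omega> \<phi> \<longrightarrow>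
        (LINT x:\<Omega>|lebesgue. rep_l2 u x * partial i \<phi> x) = - (LINT x:\<Omega>|lebesgue. rep_l2 w x * \<phi> x))"

definition H1 :: "(real^'n) set \<Rightarrow> (real^'n) l2 set" where
  "H1 \<Omega> = {u \<in> L2_space \<Omega>. \<forall>i. \<exists>w. has_weak_partial \<Omega> i u w}"

text \<open>For open \<open>\<Omega>\<close> the weak derivative is unique (fundamental lemma of the calculus of
  variations).\<close>

definition weak_partial :: "(real^'n) set \<Rightarrow> 'n \<Rightarrow> (real^'n) l2 \<Rightarrow> (real^'n) l2" where
  "weak_partial \<Omega> i u = (THE w. has_weak_partial \<Omega> i u w)"

definition H1_norm :: "(real^'n) set \<Rightarrow> (real^'n) l2 \<Rightarrow> real" where
  "H1_norm \<Omega> u = sqrt ((norm u)\<^sup>2 + (\<Sum>i\<in>UNIV. (norm (weak_partial \<Omega> i u))\<^sup>2))"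

text \<open>The topology of \<open>H1 \<Omega>\<close>; it is finer than the one inherited from the type \<open>l2\<close>.\<close>

definition H1_topology :: "(real^'n) set \<Rightarrow> (real^'n) l2 topology" where
  "H1_topology \<Omega> = Metric_space.mtopology (H1 \<Omega>) (\<lambda>u v. H1_norm \<Omega> (u - v))"

text \<open>Boundary functions are represented by ordinary functions, of which only the class modulo
  a.e. equality with respect to the surface measure matters. The trace operator is the
  continuous extension of \<open>\<phi> \<mapsto> \<phi>|\<^sub>\<partial>\<^sub>\<Omega>\<close> from functions smooth up to the boundary:
  \<open>g\<close> is the trace of \<open>u\<close> iff some sequence of smooth functions converges to \<open>u\<close>
  in \<open>H\<^sup>1(\<Omega>)\<close> and has boundary values converging to \<open>g\<close> in \<open>L\<^sup>2(\<partial>\<Omega>)\<close>.\<close>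

definition has_trace :: "(real^'n) set \<Rightarrow> (real^'n) l2 \<Rightarrow> (real^'n \<Rightarrow> real) \<Rightarrow> bool" where
  "has_trace \<Omega> u g \<longleftrightarrow> u \<in> H1 \<Omega> \<and> g \<in> borel_measurable (surface_measure \<Omega>) \<and>
     (\<exists>\<phi>. (\<forall>m. smooth (\<phi> m)) \<and>
        (\<lambda>m. H1_norm \<Omega> (l2_restrict \<Omega> (\<phi> m) - u)) \<longlonglongrightarrow> 0 \<and>
        (\<lambda>m. \<integral>\<^sup>+x. ennreal ((\<phi> m x - g x)\<^sup>2) \<partial>surface_measure \<Omega>) \<longlonglongrightarrow> 0)"

text \<open>The Sobolev--Slobodeckij space of order \<open>1/2\<close>. The boundary has dimension \<open>n - 1\<close>, so the
  exponent of \<open>dist x y\<close> is \<open>(n - 1) + 2 * (1/2) = n\<close>.\<close>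

definition H_half :: "(real^'n) set \<Rightarrow> (real^'n \<Rightarrow> real) set" where
  "H_half \<Omega> = {h \<in> borel_measurable (surface_measure \<Omega>).
     (\<integral>\<^sup>+x. ennreal ((h x)\<^sup>2) \<partial>surface_measure \<Omega>) < \<infinity> \<and>
     (\<integral>\<^sup>+x. \<integral>\<^sup>+y. ennreal ((h x - h y)\<^sup>2 / dist x y ^ CARD('n))
         \<partial>surface_measure \<Omega> \<partial>surface_measure \<Omega>) < \<infinity>}"


section \<open>The obstacle problem and the gap function\<close>

definition obstacle_set ::
    "(real^'n) set \<Rightarrow> (real^'n) l2 \<Rightarrow> (real^'n \<Rightarrow> real) \<Rightarrow> (real^'n) l2 set" where
  "obstacle_set \<Omega> \<psi> h =
     {u \<in> H1 \<Omega>. (AE x in lebesgue_on \<Omega>. rep_l2 \<psi> x \<le> rep_l2 u x) \<and> has_trace \<Omega> u h}"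

text \<open>Elements of the dual of \<open>H1 \<Omega>\<close> are functions on \<open>H1 \<Omega>\<close>; the duality pairing is
  application.\<close>

definition dual_norm :: "(real^'n) set \<Rightarrow> ((real^'n) l2 \<Rightarrow> real) \<Rightarrow> real" where
  "dual_norm \<Omega> F = (SUP w\<in>{w \<in> H1 \<Omega>. H1_norm \<Omega> w \<le> 1}. \<bar>F w\<bar>)"

definition A_op ::
    "(real^'n) set \<Rightarrow> real^'n \<Rightarrow> real \<Rightarrow> (real^'n) l2 \<Rightarrow> (real^'n) l2 \<Rightarrow> real" where
  "A_op \<Omega> b k u w = (LINT x:\<Omega>|lebesgue.
       (\<Sum>i\<in>UNIV. rep_l2 (weak_partial \<Omega> i u) x * rep_l2 (weak_partial \<Omega> i w) x)
     + (\<Sum>i\<in>UNIV. b $ i * rep_l2 (weak_partial \<Omega> i u) x * rep_l2 w x)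
     + k * rep_l2 u x * rep_l2 w x)"

definition L2_functional :: "(real^'n) set \<Rightarrow> (real^'n) l2 \<Rightarrow> (real^'n) l2 \<Rightarrow> real" where
  "L2_functional \<Omega> f w = (LINT x:\<Omega>|lebesgue. rep_l2 f x * rep_l2 w x)"

definition solves_VI ::
    "(real^'n) set \<Rightarrow> real^'n \<Rightarrow> real \<Rightarrow> (real^'n) l2 \<Rightarrow> (real^'n) l2 set \<Rightarrow> (real^'n) l2 \<Rightarrow> bool"
  where
  "solves_VI \<Omega> b k f K u \<longleftrightarrow>
     u \<in> K \<and> (\<forall>v\<in>K. A_op \<Omega> b k u (u - v) - L2_functional \<Omega> f (u - v) \<le> 0)"

definition gap_function ::
    "(real^'n) set \<Rightarrow> real^'n \<Rightarrow> real \<Rightarrow> (real^'n) l2 \<Rightarrow> (real^'n) l2 set \<Rightarrow> real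
      \<Rightarrow> (real^'n) l2 \<Rightarrow> ereal"
  where
  "gap_function \<Omega> b k f C \<gamma> u =
     (SUP v\<in>C. ereal (A_op \<Omega> b k u (u - v) - L2_functional \<Omega> f (u - v)
                       - 1 / (2 * \<gamma>) * (H1_norm \<Omega> (u - v))\<^sup>2))"

definition lower_semicontinuous_map :: "'a topology \<Rightarrow> ('a \<Rightarrow> ereal) \<Rightarrow> bool" where
  "lower_semicontinuous_map T g \<longleftrightarrow> (\<forall>a. openin T {x \<in> topspace T. a < g x})"

end

theory Submission
  imports Defs
begin

text \<open>
  The map \<open>u \<mapsto> (u, \<partial>\<^sub>1 u, \<dots>, \<partial>\<^sub>n u)\<close> embeds \<open>H\<^sup>1(\<Omega>)\<close> isometrically into a product of \<open>L\<^sup>2\<close> spaces.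
  It is linear because weak derivatives are unique; uniqueness comes from testing with products
  of one-dimensional bumps built from \<open>exp (-1/t)\<close>, which converge to indicators of boxes.
  Under this embedding the function inside the supremum defining \<open>G\<close> is a linear functional of
  \<open>u - v\<close> minus a positive multiple of the squared norm. Hence it is bounded above in \<open>v\<close>,
  which gives finiteness, and continuous in \<open>u\<close>, which makes the supremum lower semicontinuous.
  The choice \<open>v = u\<close> gives \<open>G \<ge> 0\<close>. If \<open>G u = 0\<close>, then testing with \<open>(1 - t) u + t v\<close> and letting
  \<open>t\<close> tend to \<open>0\<close> removes the quadratic term, so that \<open>u\<close> solves the variational inequality on
  \<open>K \<inter> Y\<close>; as \<open>u\<^sup>*\<close> also does, strong monotonicity yields \<open>u = u\<^sup>*\<close>.
\<close>

section \<open>Smooth bump functions\<close>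

lemma frechet_derivative_eq:
  "(f has_derivative f') (at x) \<Longrightarrow> frechet_derivative f (at x) = f'"
  using frechet_derivative_at by metis

text \<open>The recursion descends through partial derivatives, so it ends by comparing
  differentiability with continuity. The product rule needs this for the factor that is left
  undifferentiated.\<close>

lemma C_diff_mono: "C_diff (Suc m) \<phi> \<Longrightarrow> C_diff m \<phi>"
proof (induction m arbitrary: \<phi>)
  case 0
  then show ?case by (simp add: differentiable_imp_continuous_on)
next
  case (Suc m)
  then show ?case by (metis C_diff.simps(2))
qed

lemma C_diff_differentiable: "C_diff (Suc m) \<phi> \<Longrightarrow> \<phi> differentiable at x"
  by (simp add: differentiable_on_def)

lemma C_diff_const: "C_diff m (\<lambda>x. c)"
proof (induction m arbitrary: c)
  case (Suc m)
  then show ?case by (simp add: frechet_derivative_const)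
qed simp

lemma C_diff_add:
  assumes "C_diff m \<phi>" "C_diff m \<psi>"
  shows "C_diff m (\<lambda>x. \<phi> x + \<psi> x)"
  using assms
proof (induction m arbitrary: \<phi> \<psi>)
  case 0
  then show ?case by (auto intro: continuous_on_add)
next
  case (Suc m)
  have "partial i (\<lambda>x. \<phi> x + \<psi> x) = (\<lambda>x. partial i \<phi> x + partial i \<psi> x)" for i
    using frechet_derivative_eq[OF has_derivative_add[OF
        Suc.prems[THEN C_diff_differentiable, unfolded frechet_derivative_works]]]
    by (simp add: fun_eq_iff)
  with Suc show ?case by (auto intro: differentiable_on_add)
qed

lemma C_diff_mult:
  assumes "C_diff m \<phi>" "C_diff m \<psi>"
  shows "C_diff m (\<lambda>x. \<phi> x * \<psi> x)"
  using assms
proof (induction m arbitrary: \<phi> \<psi>)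
  case 0
  then show ?case by (auto intro: continuous_on_mult)
next
  case (Suc m)
  have "partial i (\<lambda>x. \<phi> x * \<psi> x) = (\<lambda>x. \<phi> x * partial i \<psi> x + partial i \<phi> x * \<psi> x)" for i
    using frechet_derivative_eq[OF has_derivative_mult[OF
        Suc.prems[THEN C_diff_differentiable, unfolded frechet_derivative_works]]]
    by (simp add: fun_eq_iff)
  moreover have "C_diff m \<phi>" "C_diff m \<psi>"
    by (rule Suc.prems[THEN C_diff_mono])+
  ultimately show ?case
    using Suc by (auto intro!: differentiable_on_mult C_diff_add)
qed

lemma C_diff_prod:
  assumes "finite I" "\<And>i. i \<in> I \<Longrightarrow> C_diff m (\<phi> i)"
  shows "C_diff m (\<lambda>x. \<Prod>i\<in>I. \<phi> i x)"
  using assms by (induction I rule: finite_induct) (auto intro: C_diff_const C_diff_mult)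

text \<open>The derivative of \<open>exp_flat k\<close> is a linear combination of \<open>exp_flat (k + 1)\<close> and
  \<open>exp_flat (k + 2)\<close>, so smoothness of all members follows by one induction.\<close>

definition exp_flat :: "nat \<Rightarrow> real \<Rightarrow> real" where
  "exp_flat k t = (if t \<le> 0 then 0 else exp (- (1 / t)) / t ^ k)"

lemma exp_flat_Suc: "exp_flat (Suc k) t = exp_flat k t / t"
  by (simp add: exp_flat_def)

text \<open>On the right, the substitution of \<open>1 / t\<close> turns the claim into the decay of
  a power divided by the exponential at infinity; on the left the function is zero.\<close>

lemma tendsto_exp_flat: "(exp_flat k \<longlongrightarrow> 0) (at 0)"
proof -
  have "((\<lambda>t. (1 / t) ^ k / exp (1 / t)) \<longlongrightarrow> 0) (at_right (0::real))"
    using filterlim_compose[OF tendsto_power_div_exp_0 filterlim_inverse_at_top_right, of k]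
    by (simp add: inverse_eq_divide)
  moreover have "\<forall>\<^sub>F t in at_right 0. (1 / t) ^ k / exp (1 / t) = exp_flat k t"
    by (auto simp: eventually_at_filter exp_flat_def exp_minus field_simps power_one_over)
  ultimately have "(exp_flat k \<longlongrightarrow> 0) (at_right 0)"
    by (rule Lim_transform_eventually)
  moreover have "(exp_flat k \<longlongrightarrow> 0) (at_left 0)"
    by (rule Lim_transform_eventually[OF tendsto_const])
      (auto simp: eventually_at_filter exp_flat_def)
  ultimately show ?thesis by (simp add: filterlim_split_at)
qed

lemma has_real_derivative_exp_flat:
  "(exp_flat k has_real_derivative exp_flat (Suc (Suc k)) t - real k * exp_flat (Suc k) t) (at t)"
proof -
  consider "t < 0" | "t = 0" | "0 < t" by linarith
  then show ?thesis
  proof cases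
    case 1
    have "((\<lambda>t. 0) has_real_derivative 0) (at t)" by simp
    then have "(exp_flat k has_real_derivative 0) (at t)"
      by (rule has_field_derivative_transform_within_open[where S="{..<0}"])
        (use 1 in \<open>auto simp: exp_flat_def\<close>)
    then show ?thesis using 1 by (simp add: exp_flat_def)
  next
    case 2
    \<comment> \<open>The difference quotient at 0 is the next member of the family, so its limit is
      already known.\<close>
    have "exp_flat (Suc k) = (\<lambda>y. (exp_flat k (0 + y) - exp_flat k 0) / y)"
      by (simp add: fun_eq_iff exp_flat_Suc) (simp add: exp_flat_def)
    then have "(exp_flat k has_real_derivative 0) (at 0)"
      using tendsto_exp_flat[of "Suc k"] by (simp add: DERIV_def)
    then show ?thesis
      by (simp add: 2) (simp add: exp_flat_def)
  next
    case 3
    \<comment> \<open>The case \<open>k = 0\<close> is separate because the power rule produces the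
      exponent \<open>k - 1\<close>.\<close>
    have "((\<lambda>t. exp (- (1 / t)) / t ^ k) has_real_derivative
        exp_flat (Suc (Suc k)) t - real k * exp_flat (Suc k) t) (at t)"
      using 3
      by (cases "k = 0") (auto intro!: derivative_eq_intros
          simp: exp_flat_def field_simps power2_eq_square power_eq_if[of t k])
    then show ?thesis
      by (rule has_field_derivative_transform_within_open[where S="{0<..}"])
        (use 3 in \<open>auto simp: exp_flat_def\<close>)
  qed
qed

text \<open>The derivative is written as a sum of products, with the constant factor
  \<open>- real k\<close>, so that the closure rules for \<open>C_diff\<close> apply to it
  directly.\<close>

lemma has_derivative_exp_flat_affine:
  "((\<lambda>x :: real^'n. exp_flat k (c + s * x $ j)) has_derivative
    (\<lambda>v. (exp_flat (Suc (Suc k)) (c + s * x $ j) + (- real k) * exp_flat (Suc k) (c + s * x $ j))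
        * (s * v $ j))) (at x)"
proof -
  have "((\<lambda>x :: real^'n. c + s * x $ j) has_derivative (\<lambda>v. s * v $ j)) (at x)"
    by (auto intro!: derivative_eq_intros bounded_linear_vec_nth bounded_linear_imp_has_derivative)
  from has_derivative_compose[OF this
      has_real_derivative_exp_flat[unfolded has_field_derivative_def], of k]
  show ?thesis by simp
qed

lemma C_diff_exp_flat: "C_diff m (\<lambda>x :: real^'n. exp_flat k (c + s * x $ j))"
proof (induction m arbitrary: k)
  case 0
  show ?case
    using has_derivative_continuous_on[OF has_derivative_at_withinI[OF has_derivative_exp_flat_affine]]
    by simp
next
  case (Suc m)
  have "partial i (\<lambda>x :: real^'n. exp_flat k (c + s * x $ j)) = (\<lambda>x.
      (exp_flat (Suc (Suc k)) (c + s * x $ j) + (- real k) * exp_flat (Suc k) (c + s * x $ j))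
        * (s * axis i 1 $ j))" for i
    by (intro ext) (simp only: frechet_derivative_eq[OF has_derivative_exp_flat_affine])
  moreover have "(\<lambda>x :: real^'n. exp_flat k (c + s * x $ j)) differentiable_on UNIV"
    by (intro differentiable_at_imp_differentiable_on differentiableI[OF has_derivative_exp_flat_affine])
  moreover have "C_diff m (\<lambda>x :: real^'n.
      (exp_flat (Suc (Suc k)) (c + s * x $ j) + (- real k) * exp_flat (Suc k) (c + s * x $ j))
        * (s * axis i 1 $ j))" for i
    by (intro C_diff_mult C_diff_add C_diff_const Suc.IH)
  ultimately show ?case by simp
qed

lemma exp_flat_nonneg: "0 \<le> exp_flat 0 t" and exp_flat_le_1: "exp_flat 0 t \<le> 1"
  by (auto simp: exp_flat_def)

text \<open>For positive \<open>t\<close> the exponent \<open>- 1 / ((m + 1) * t)\<close> tends to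
  0; otherwise every term vanishes. The factor \<open>Suc m\<close> keeps the scaling positive from
  the first term on.\<close>

lemma tendsto_exp_flat_scaled:
  "(\<lambda>m. exp_flat 0 (real (Suc m) * t)) \<longlonglongrightarrow> (if 0 < t then 1 else 0)"
proof (cases "0 < t")
  case True
  have "(\<lambda>m. inverse (real (Suc m)) * (1 / t)) \<longlonglongrightarrow> 0 * (1 / t)"
    by (intro tendsto_mult LIMSEQ_inverse_real_of_nat tendsto_const)
  then have "(\<lambda>m. exp (- (inverse (real (Suc m)) * (1 / t)))) \<longlonglongrightarrow> exp (- (0 * (1 / t)))"
    by (intro tendsto_exp tendsto_minus)
  moreover have "exp_flat 0 (real (Suc m) * t) = exp (- (inverse (real (Suc m)) * (1 / t)))" for m
    using True mult_pos_pos[of "real (Suc m)" t] by (simp add: exp_flat_def inverse_eq_divide not_le)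
  ultimately show ?thesis using True by simp
next
  case False
  then show ?thesis by (simp add: exp_flat_def mult_le_0_iff)
qed

text \<open>Each coordinate contributes one factor that vanishes below \<open>a $ i\<close> and one
  that vanishes above \<open>b $ i\<close>. Growing \<open>m\<close> steepens them towards the
  indicator of the open box.\<close>

definition box_bump :: "real^'n \<Rightarrow> real^'n \<Rightarrow> nat \<Rightarrow> real^'n \<Rightarrow> real" where
  "box_bump a b m x =
     (\<Prod>i\<in>UNIV. exp_flat 0 (real (Suc m) * (x $ i - a $ i)) * exp_flat 0 (real (Suc m) * (b $ i - x $ i)))"

lemma smooth_box_bump: "smooth (box_bump a b m)"
proof -
  have "C_diff l (box_bump a b m)" for l
  proof -
    \<comment> \<open>The arguments are brought into the form \<open>c + s * x $ i\<close> of
      \<open>C_diff_exp_flat\<close>.\<close>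
    have "C_diff l (\<lambda>x. exp_flat 0 (- real (Suc m) * a $ i + real (Suc m) * x $ i)
        * exp_flat 0 (real (Suc m) * b $ i + (- real (Suc m)) * x $ i))" for i
      by (intro C_diff_mult C_diff_exp_flat)
    then have "C_diff l (\<lambda>x. \<Prod>i\<in>UNIV. exp_flat 0 (- real (Suc m) * a $ i + real (Suc m) * x $ i)
        * exp_flat 0 (real (Suc m) * b $ i + (- real (Suc m)) * x $ i))"
      by (intro C_diff_prod) auto
    moreover have "box_bump a b m = (\<lambda>x. \<Prod>i\<in>UNIV.
        exp_flat 0 (- real (Suc m) * a $ i + real (Suc m) * x $ i)
        * exp_flat 0 (real (Suc m) * b $ i + (- real (Suc m)) * x $ i))"
      unfolding box_bump_def fun_eq_iff by (simp add: right_diff_distrib algebra_simps)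
    ultimately show ?thesis by simp
  qed
  then show ?thesis by (simp add: smooth_def)
qed

lemma box_bump_bounds: "0 \<le> box_bump a b m x" "box_bump a b m x \<le> 1"
  unfolding box_bump_def
  by (auto intro!: prod_nonneg prod_le_1 mult_le_one exp_flat_nonneg exp_flat_le_1 mult_nonneg_nonneg
      simp del: of_nat_Suc)

lemma box_bump_eq_0:
  assumes "x \<notin> box a b"
  shows "box_bump a b m x = 0"
proof -
  obtain i where "x $ i \<le> a $ i \<or> b $ i \<le> x $ i"
    using assms by (auto simp: mem_box_cart not_less)
  then have "exp_flat 0 (real (Suc m) * (x $ i - a $ i)) * exp_flat 0 (real (Suc m) * (b $ i - x $ i)) = 0"
    by (auto simp: exp_flat_def mult_le_0_iff simp del: of_nat_Suc)
  then show ?thesis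
    unfolding box_bump_def by (intro prod_zero finite bexI[of _ i]) simp_all
qed

lemma tendsto_box_bump: "(\<lambda>m. box_bump a b m x) \<longlonglongrightarrow> (indicator (box a b) x :: real)"
proof (cases "x \<in> box a b")
  case True
  have "(\<lambda>m. box_bump a b m x) \<longlonglongrightarrow>
      (\<Prod>i\<in>UNIV. (if 0 < x $ i - a $ i then 1 else 0) * (if 0 < b $ i - x $ i then 1 else 0))"
    unfolding box_bump_def by (intro tendsto_prod tendsto_mult tendsto_exp_flat_scaled)
  then show ?thesis
    using True by (simp add: mem_box_cart)
qed (simp add: box_bump_eq_0)

text \<open>The closed box appears because the closure of the support has to stay inside
  \<Omega>.\<close>

lemma test_function_box_bump:
  assumes "cbox a b \<subseteq> \<Omega>"
  shows "test_function \<Omega> (box_bump a b m)"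
proof -
  have "{x. box_bump a b m x \<noteq> 0} \<subseteq> cbox a b"
    using box_bump_eq_0 box_subset_cbox by blast
  then have cl: "closure {x. box_bump a b m x \<noteq> 0} \<subseteq> cbox a b"
    by (rule closure_minimal[OF _ closed_cbox])
  then have "compact (closure {x. box_bump a b m x \<noteq> 0})"
    by (meson bounded_cbox bounded_subset closed_closure compact_eq_bounded_closed)
  with cl assms show ?thesis by (auto simp: test_function_def smooth_box_bump)
qed

section \<open>The fundamental lemma of the calculus of variations\<close>

text \<open>A Dynkin system argument: boxes form an intersection-stable generator of the Borel sets,
  so the integral vanishes over every Borel set, in particular where the function is positive and
  where it is negative.\<close>

lemma AE_eq_0_if_box_integrals_eq_0:
  fixes g :: "'a::euclidean_space \<Rightarrow> real"
  assumes g: "integrable lebesgue g" and g0: "integral\<^sup>L lebesgue g = 0"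
    and box0: "\<And>c d. (LINT x:box c d|lebesgue. g x) = 0"
  shows "AE x in lebesgue. g x = 0"
proof -
  \<comment> \<open>Boxes generate only the Borel sets, hence the passage to a Borel function that
    agrees almost everywhere.\<close>
  obtain g' where g': "g' \<in> borel_measurable lborel" and ae: "AE x in lborel. g x = g' x"
    using completion_ex_borel_measurable_real[OF borel_measurable_integrable[OF g]] by auto
  have [measurable]: "g' \<in> borel_measurable borel" using g' by simp
  have [measurable]: "g' \<in> borel_measurable lebesgue" "g \<in> borel_measurable lebesgue"
    using g' g by (auto intro: measurable_completion)
  have ae': "AE x in lebesgue. g x = g' x"
    using ae by (rule AE_completion)
  have g'_int: "integrable lborel g'"
    using g g' ae' integrable_cong_AE[of g lebesgue g']
    by (metis borel_measurable_integrable integrable_completion measurable_completion)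
  have cong: "(LINT x:A|lborel. g' x) = (LINT x:A|lebesgue. g x)" if [measurable]: "A \<in> sets borel" for A
  proof -
    have "(LINT x:A|lborel. g' x) = (LINT x:A|lebesgue. g' x)"
      unfolding set_lebesgue_integral_def by (rule integral_completion[symmetric]) simp
    also have "\<dots> = (LINT x:A|lebesgue. g x)"
    proof -
      have [measurable]: "A \<in> sets lebesgue" by simp
      show ?thesis
        unfolding set_lebesgue_integral_def by (rule integral_cong_AE) (use ae' in auto)
    qed
    finally show ?thesis .
  qed
  have set_int: "set_integrable lborel A g'" if "A \<in> sets borel" for A
    using that g'_int unfolding set_integrable_def
    by (intro integrable_mult_indicator) auto
  have zero: "(LINT x:A|lborel. g' x) = 0" if "A \<in> sets borel" for A
  proof -
    have "Int_stable (range (\<lambda>(a, b). box a b :: 'a set))"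
      by (auto simp: Int_stable_def box_Int_box)
    moreover have "range (\<lambda>(a, b). box a b :: 'a set) \<subseteq> Pow UNIV" by simp
    moreover have "A \<in> sigma_sets UNIV (range (\<lambda>(a, b). box a b :: 'a set))"
      using that by (simp add: borel_eq_box)
    ultimately show ?thesis
    proof (induction rule: sigma_sets_induct_disjoint)
      case (basic A)
      then show ?case using cong box0 by fastforce
    next
      case empty
      then show ?case by (simp add: set_lebesgue_integral_def)
    next
      case (compl A)
      then have A: "A \<in> sets borel" by (simp add: borel_eq_box)
      have "(LINT x:A \<union> (UNIV - A)|lborel. g' x)
          = (LINT x:A|lborel. g' x) + (LINT x:UNIV - A|lborel. g' x)"
        using A by (intro set_integral_Un set_int) auto
      \<comment> \<open>Complements are handled through the vanishing integral over the whole
        space.\<close>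
      moreover have "(LINT x:A \<union> (UNIV - A)|lborel. g' x) = 0"
        using cong[of UNIV] g0 by (simp add: set_lebesgue_integral_def)
      ultimately show ?case using compl by simp
    next
      case (union A)
      then have A: "A i \<in> sets borel" for i by (auto simp: borel_eq_box)
      then have "(LINT x:(\<Union>i. A i)|lborel. g' x) = (\<Sum>i. LINT x:A i|lborel. g' x)"
        using union(1) by (intro lebesgue_integral_countable_add set_int) (auto simp: disjoint_family_on_def)
      then show ?case using union by simp
    qed
  qed
  have "{x. 0 < g' x} \<in> null_sets lborel"
    by (rule null_if_pos_func_has_zero_int[OF g'_int _ _ zero]) auto
  moreover have "{x. g' x < 0} \<in> null_sets lborel"
    by (rule null_if_pos_func_has_zero_int[where f="\<lambda>x. - g' x"])
      (use g'_int zero[of "{x. g' x < 0}"] in \<open>auto simp: set_lebesgue_integral_def\<close>)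
  ultimately have "AE x in lborel. x \<notin> {x. 0 < g' x} \<and> x \<notin> {x. g' x < 0}"
    by (intro AE_conjI AE_not_in)
  then have "AE x in lborel. g' x = 0"
    by eventually_elim auto
  then have "AE x in lebesgue. g' x = 0"
    by (rule AE_completion)
  with ae' show ?thesis by eventually_elim simp
qed

section \<open>Representatives of \<open>l2\<close> classes and integrals over \<Omega> as inner
  products\<close>

lemma AE_rep_abs: "sq_integrable f \<Longrightarrow> AE x in lebesgue. rep_l2 (abs_l2 f) x = f x"
  using Quotient3_rep_abs[OF Quotient3_l2, of f] by (simp add: l2_rel_def)

lemma sq_integrable_rep: "sq_integrable (rep_l2 u)"
  using Quotient3_rep_reflp[OF Quotient3_l2, of u] by (simp add: l2_rel_def)

lemma borel_measurable_rep_l2 [measurable]: "rep_l2 u \<in> borel_measurable lebesgue"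
  using sq_integrable_rep[of u] by (simp add: sq_integrable_def)

lemma rep_l2_zero: "AE x in lebesgue. rep_l2 0 x = 0"
  unfolding zero_l2_def by (rule AE_rep_abs) (rule sq_integrable_zero)

lemma rep_l2_add: "AE x in lebesgue. rep_l2 (u + v) x = rep_l2 u x + rep_l2 v x"
  unfolding plus_l2_def
  by (simp add: AE_rep_abs sq_integrable_add sq_integrable_rep)

lemma rep_l2_scaleR: "AE x in lebesgue. rep_l2 (c *\<^sub>R u) x = c * rep_l2 u x"
  unfolding scaleR_l2_def
  by (simp add: AE_rep_abs sq_integrable_scale sq_integrable_rep)

lemma l2_eq_0_iff: "u = 0 \<longleftrightarrow> (AE x in lebesgue. rep_l2 u x = 0)"
proof
  assume "AE x in lebesgue. rep_l2 u x = 0"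
  then have "u \<bullet> u = 0"
    unfolding inner_l2.rep_eq by (intro integral_eq_zero_AE) auto
  then show "u = 0" by simp
qed (use rep_l2_zero in simp)

lemma subspace_L2_space: "subspace (L2_space \<Omega>)"
proof (rule subspaceI)
  show "0 \<in> L2_space \<Omega>"
    unfolding L2_space_def using rep_l2_zero by (auto elim: eventually_mono)
next
  fix u v assume "u \<in> L2_space \<Omega>" "v \<in> L2_space \<Omega>"
  then have "AE x in lebesgue. x \<notin> \<Omega> \<longrightarrow> rep_l2 u x = 0" "AE x in lebesgue. x \<notin> \<Omega> \<longrightarrow> rep_l2 v x = 0"
    by (auto simp: L2_space_def)
  with rep_l2_add[of u v] have "AE x in lebesgue. x \<notin> \<Omega> \<longrightarrow> rep_l2 (u + v) x = 0"
    by eventually_elim simp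
  then show "u + v \<in> L2_space \<Omega>" by (simp add: L2_space_def)
next
  fix c u assume "u \<in> L2_space \<Omega>"
  then have "AE x in lebesgue. x \<notin> \<Omega> \<longrightarrow> rep_l2 u x = 0"
    by (simp add: L2_space_def)
  with rep_l2_scaleR[of c u] have "AE x in lebesgue. x \<notin> \<Omega> \<longrightarrow> rep_l2 (c *\<^sub>R u) x = 0"
    by eventually_elim simp
  then show "c *\<^sub>R u \<in> L2_space \<Omega>" by (simp add: L2_space_def)
qed

lemma sq_integrable_indicator_mult:
  assumes "sq_integrable g" and [measurable]: "\<Omega> \<in> sets lebesgue"
  shows "sq_integrable (\<lambda>x. indicator \<Omega> x * g x)"
proof -
  have [measurable]: "g \<in> borel_measurable lebesgue" using assms by (simp add: sq_integrable_def)
  have "integrable lebesgue (\<lambda>x. indicator \<Omega> x *\<^sub>R (g x)\<^sup>2)"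
    using assms by (intro integrable_mult_indicator) (auto simp: sq_integrable_def)
  moreover have "indicator \<Omega> x *\<^sub>R (g x)\<^sup>2 = (indicator \<Omega> x * g x)\<^sup>2" for x
    by (auto simp: indicator_def)
  ultimately show ?thesis by (simp add: sq_integrable_def)
qed

text \<open>Turns the integrals in the definition of weak derivatives into inner products, whose
  linearity then replaces integrability arguments.\<close>

lemma set_integral_rep_mult:
  assumes g: "sq_integrable g" and [measurable]: "\<Omega> \<in> sets lebesgue"
  shows "(LINT x:\<Omega>|lebesgue. rep_l2 u x * g x) = u \<bullet> l2_restrict \<Omega> g"
proof -
  have [measurable]: "g \<in> borel_measurable lebesgue" using g by (simp add: sq_integrable_def)
  have ae: "AE x in lebesgue. rep_l2 (l2_restrict \<Omega> g) x = indicator \<Omega> x * g x"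
    unfolding l2_restrict_def by (intro AE_rep_abs sq_integrable_indicator_mult assms)
  show ?thesis
    unfolding inner_l2.rep_eq set_lebesgue_integral_def
    by (rule integral_cong_AE) (use ae in \<open>auto elim!: eventually_mono\<close>)
qed

text \<open>As \<open>w\<close> vanishes almost everywhere outside \<Omega>, integrating over
  \<Omega> or over the whole space gives the same value.\<close>

lemma set_integral_rep_rep:
  assumes w: "w \<in> L2_space \<Omega>" and [measurable]: "\<Omega> \<in> sets lebesgue"
  shows "(LINT x:\<Omega>|lebesgue. rep_l2 u x * rep_l2 w x) = u \<bullet> w"
proof -
  have ae: "AE x in lebesgue. x \<notin> \<Omega> \<longrightarrow> rep_l2 w x = 0"
    using w by (simp add: L2_space_def)
  show ?thesis
    unfolding inner_l2.rep_eq set_lebesgue_integral_def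
    by (rule integral_cong_AE) (use ae in \<open>auto elim!: eventually_mono simp: indicator_def\<close>)
qed

lemma set_integrable_rep_rep:
  assumes "\<Omega> \<in> sets lebesgue"
  shows "set_integrable lebesgue \<Omega> (\<lambda>x. rep_l2 u x * rep_l2 w x)"
  unfolding set_integrable_def
  by (intro integrable_mult_indicator sq_integrable_mult sq_integrable_rep assms)

section \<open>Square integrability of test functions and their derivatives\<close>

lemma sq_integrable_continuous_bounded_support:
  fixes g :: "'a::euclidean_space \<Rightarrow> real"
  assumes cont: "continuous_on UNIV g" and S: "compact S" and 0: "\<And>x. x \<notin> S \<Longrightarrow> g x = 0"
  shows "sq_integrable g"
proof -
  have [measurable]: "g \<in> borel_measurable borel"
    by (rule borel_measurable_continuous_onI[OF cont])
  have "integrable lborel (\<lambda>x. indicator S x *\<^sub>R (g x)\<^sup>2)"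
    by (intro borel_integrable_compact S continuous_intros continuous_on_subset[OF cont]) simp
  moreover have "(\<lambda>x. indicator S x *\<^sub>R (g x)\<^sup>2) = (\<lambda>x. (g x)\<^sup>2)"
    using 0 by (force simp: indicator_def)
  ultimately have "integrable lborel (\<lambda>x. (g x)\<^sup>2)" by simp
  then have "integrable lebesgue (\<lambda>x. (g x)\<^sup>2)"
    by (subst integrable_completion) auto
  then show ?thesis
    by (auto simp: sq_integrable_def intro: measurable_completion)
qed

text \<open>The complement of the closed support is open and \<phi> is zero there, so its derivative
  is zero there as well.\<close>

lemma test_function_eq_0:
  assumes "x \<notin> closure {x. \<phi> x \<noteq> 0}"
  shows "\<phi> x = 0" "partial i \<phi> x = 0"
proof -
  have zero: "\<phi> y = 0" if "y \<in> - closure {x. \<phi> x \<noteq> 0}" for y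
    using that closure_subset[of "{x. \<phi> x \<noteq> 0}"] by blast
  then show "\<phi> x = 0" using assms by blast
  have "((\<lambda>_. 0 :: real) has_derivative (\<lambda>_. 0)) (at x)" by (rule has_derivative_const)
  then have "(\<phi> has_derivative (\<lambda>_. 0)) (at x)"
    by (rule has_derivative_transform_within_open[where s="- closure {x. \<phi> x \<noteq> 0}"])
      (rule open_Compl[OF closed_closure], rule iffD2[OF Compl_iff assms], rule zero[symmetric])
  from frechet_derivative_eq[OF this] show "partial i \<phi> x = 0" by simp
qed

lemma test_function_sq_integrable:
  assumes "test_function \<Omega> \<phi>"
  shows "sq_integrable \<phi>" "sq_integrable (partial i \<phi>)"
proof -
  have "C_diff 0 \<phi>" "C_diff 1 \<phi>" and S: "compact (closure {x. \<phi> x \<noteq> 0})"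
    using assms unfolding test_function_def smooth_def by blast+
  then have cont: "continuous_on UNIV \<phi>" "continuous_on UNIV (partial i \<phi>)" by auto
  show "sq_integrable \<phi>"
    by (rule sq_integrable_continuous_bounded_support[OF cont(1) S test_function_eq_0(1)[of _ \<phi>]])
  show "sq_integrable (partial i \<phi>)"
    by (rule sq_integrable_continuous_bounded_support[OF cont(2) S test_function_eq_0(2)[of _ \<phi> i]])
qed

text \<open>In this form every condition is linear in the pair of \<open>u\<close> and
  \<open>w\<close>, which yields both linearity and uniqueness of weak derivatives.\<close>

lemma has_weak_partial_iff_inner:
  assumes "\<Omega> \<in> sets lebesgue"
  shows "has_weak_partial \<Omega> i u w \<longleftrightarrow> w \<in> L2_space \<Omega> \<and> (\<forall>\<phi>. test_function \<Omega> \<phi> \<longrightarrow>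
    u \<bullet> l2_restrict \<Omega> (partial i \<phi>) = - (w \<bullet> l2_restrict \<Omega> \<phi>))"
proof -
  have eq: "(LINT x:\<Omega>|lebesgue. rep_l2 u x * partial i \<phi> x) = u \<bullet> l2_restrict \<Omega> (partial i \<phi>)"
    "(LINT x:\<Omega>|lebesgue. rep_l2 w x * \<phi> x) = w \<bullet> l2_restrict \<Omega> \<phi>"
    if "test_function \<Omega> \<phi>" for \<phi>
    by (rule set_integral_rep_mult[OF test_function_sq_integrable(2)[OF that] assms],
        rule set_integral_rep_mult[OF test_function_sq_integrable(1)[OF that] assms])
  show ?thesis
    unfolding has_weak_partial_def
    by (intro conj_cong all_cong1 imp_cong refl arg_cong2[where f="(=)"] arg_cong[where f=uminus] eq)
qed

lemma sq_integrable_indicator: "S \<in> lmeasurable \<Longrightarrow> sq_integrable (indicator S)"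
  by (auto simp: sq_integrable_def power2_eq_square lmeasurable_iff_integrable
      simp flip: indicator_inter_arith)

text \<open>The bumps are admissible test functions and converge to indicators of boxes, so the
  integral of \<open>w\<close> vanishes over each open box whose closed box lies in
  \<Omega>.\<close>

lemma AE_eq_0_on_cbox:
  fixes a b :: "real^'n"
  assumes orth: "\<And>\<phi>. test_function \<Omega> \<phi> \<Longrightarrow> (LINT x:\<Omega>|lebesgue. rep_l2 w x * \<phi> x) = 0"
    and sub: "cbox a b \<subseteq> \<Omega>"
  shows "AE x in lebesgue. x \<in> cbox a b \<longrightarrow> rep_l2 w x = 0"
proof -
  have box0: "(LINT x:box c d|lebesgue. rep_l2 w x) = 0" if cd: "cbox c d \<subseteq> \<Omega>" for c d
  proof -
    have eq: "indicator \<Omega> x *\<^sub>R (rep_l2 w x * box_bump c d m x) = rep_l2 w x * box_bump c d m x" for m x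
      using cd box_bump_eq_0[of x c d m] box_subset_cbox[of c d] by (auto simp: indicator_def)
    have "(\<lambda>m. LINT x:\<Omega>|lebesgue. rep_l2 w x * box_bump c d m x) \<longlonglongrightarrow> (LINT x:box c d|lebesgue. rep_l2 w x)"
      unfolding set_lebesgue_integral_def
    proof (rule integral_dominated_convergence)
      \<comment> \<open>The majorant is integrable as a product of two square-integrable functions,
        since the closed box has finite measure.\<close>
      show "integrable lebesgue (\<lambda>x. \<bar>rep_l2 w x * indicator (cbox c d) x\<bar>)"
        by (intro integrable_abs sq_integrable_mult sq_integrable_rep sq_integrable_indicator) simp
      show "AE x in lebesgue. (\<lambda>m. indicator \<Omega> x *\<^sub>R (rep_l2 w x * box_bump c d m x))
          \<longlonglongrightarrow> indicator (box c d) x *\<^sub>R rep_l2 w x"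
        using tendsto_mult_left[OF tendsto_box_bump] unfolding eq
        by (intro AE_I2) (simp add: mult.commute)
      show "AE x in lebesgue. norm (indicator \<Omega> x *\<^sub>R (rep_l2 w x * box_bump c d m x))
          \<le> \<bar>rep_l2 w x * indicator (cbox c d) x\<bar>" for m
      proof (rule AE_I2)
        fix x
        have "\<bar>box_bump c d m x\<bar> \<le> indicator (cbox c d) x"
          using box_bump_bounds[of c d m x] box_bump_eq_0[of x c d m] box_subset_cbox[of c d]
          by (auto simp: indicator_def)
        then show "norm (indicator \<Omega> x *\<^sub>R (rep_l2 w x * box_bump c d m x))
            \<le> \<bar>rep_l2 w x * indicator (cbox c d) x\<bar>"
          unfolding eq by (simp add: abs_mult mult_left_mono)
      qed
      show "(\<lambda>x. indicator \<Omega> x *\<^sub>R (rep_l2 w x * box_bump c d m x)) \<in> borel_measurable lebesgue" for m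
        using test_function_sq_integrable(1)[OF test_function_box_bump[OF cd], of m]
        unfolding eq sq_integrable_def by (auto intro: borel_measurable_times)
    qed (intro borel_measurable_scaleR borel_measurable_indicator borel_measurable_rep_l2, simp)
    then show ?thesis
      using orth[OF test_function_box_bump[OF cd]] by (simp add: LIMSEQ_const_iff)
  qed
  \<comment> \<open>Cutting off outside \<open>box a b\<close> makes the function integrable and
    reduces its integral over an arbitrary box to one over the intersection, which is a box
    again.\<close>
  define g where "g = (\<lambda>x. indicator (box a b) x * rep_l2 w x)"
  have "AE x in lebesgue. g x = 0"
  proof (rule AE_eq_0_if_box_integrals_eq_0)
    show "integrable lebesgue g"
      unfolding g_def
      by (intro sq_integrable_mult sq_integrable_rep sq_integrable_indicator) simp
    show "integral\<^sup>L lebesgue g = 0"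
      using box0[OF sub] by (simp add: g_def set_lebesgue_integral_def)
    fix c d :: "real^'n"
    have "(LINT x:box c d|lebesgue. g x) = (LINT x:box c d \<inter> box a b|lebesgue. rep_l2 w x)"
      by (simp add: g_def set_lebesgue_integral_def indicator_inter_arith mult.assoc)
    also have "\<dots> = 0"
      unfolding box_Int_box using sub
      by (intro box0) (auto simp flip: Int_interval)
    finally show "(LINT x:box c d|lebesgue. g x) = 0" .
  qed
  \<comment> \<open>The faces of the box, where \<open>g\<close> gives no information, form a null
    set.\<close>
  moreover have "AE x in lebesgue. x \<notin> cbox a b - box a b"
    using negligible_frontier_interval[of a b]
    by (intro AE_not_in) (simp add: negligible_iff_null_sets)
  ultimately show ?thesis
    by eventually_elim (auto simp: g_def)
qed

text \<open>An open set is a countable union of closed boxes, so the exceptional null sets of the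
  boxes add up to a null set; outside \<Omega> the function vanishes by membership in
  \<open>L2_space\<close>.\<close>

lemma fundamental_lemma:
  assumes "open \<Omega>" and w: "w \<in> L2_space \<Omega>"
    and orth: "\<And>\<phi>. test_function \<Omega> \<phi> \<Longrightarrow> (LINT x:\<Omega>|lebesgue. rep_l2 w x * \<phi> x) = 0"
  shows "w = 0"
proof -
  obtain D where D: "countable D" "\<And>X. X \<in> D \<Longrightarrow> X \<subseteq> \<Omega>" "\<And>X. X \<in> D \<Longrightarrow> \<exists>a b. X = cbox a b" "\<Union>D = \<Omega>"
    using open_countable_Union_open_cbox[OF \<open>open \<Omega>\<close>] by (metis PowD subsetD)
  have "AE x in lebesgue. \<forall>X\<in>D. x \<in> X \<longrightarrow> rep_l2 w x = 0"
    unfolding AE_ball_countable[OF D(1)] using AE_eq_0_on_cbox[OF orth] D(2,3) by metis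
  moreover have "AE x in lebesgue. x \<notin> \<Omega> \<longrightarrow> rep_l2 w x = 0"
    using w by (simp add: L2_space_def)
  ultimately have "AE x in lebesgue. rep_l2 w x = 0"
    by eventually_elim (use D(4) in blast)
  then show ?thesis by (simp add: l2_eq_0_iff)
qed

section \<open>Weak derivatives and the space \<open>H\<^sup>1\<close>\<close>

text \<open>The difference of two weak derivatives is orthogonal to all test functions. This makes
  \<open>THE\<close> in \<open>weak_partial\<close> meaningful.\<close>

lemma has_weak_partial_unique:
  assumes "open \<Omega>" "has_weak_partial \<Omega> i u w" "has_weak_partial \<Omega> i u w'"
  shows "w = w'"
proof -
  have [simp]: "\<Omega> \<in> sets lebesgue" using assms(1) by auto
  have "w - w' = 0"
  proof (rule fundamental_lemma[OF assms(1)])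
    show "w - w' \<in> L2_space \<Omega>"
      using assms by (auto simp: has_weak_partial_def intro: subspace_diff[OF subspace_L2_space])
    show "(LINT x:\<Omega>|lebesgue. rep_l2 (w - w') x * \<phi> x) = 0" if "test_function \<Omega> \<phi>" for \<phi>
      using assms(2,3) that
      by (simp add: has_weak_partial_iff_inner set_integral_rep_mult test_function_sq_integrable inner_diff_left)
  qed
  then show ?thesis by simp
qed

lemma has_weak_partial_linear:
  assumes "\<Omega> \<in> sets lebesgue" "has_weak_partial \<Omega> i u w" "has_weak_partial \<Omega> i v z"
  shows "has_weak_partial \<Omega> i (c *\<^sub>R u + d *\<^sub>R v) (c *\<^sub>R w + d *\<^sub>R z)"
  using assms by (auto simp: has_weak_partial_iff_inner inner_add_left
      intro!: subspace_add[OF subspace_L2_space] subspace_scale[OF subspace_L2_space])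

lemma weak_partial_eq: "open \<Omega> \<Longrightarrow> has_weak_partial \<Omega> i u w \<Longrightarrow> weak_partial \<Omega> i u = w"
  unfolding weak_partial_def by (blast intro: has_weak_partial_unique)

lemma has_weak_partial_weak_partial:
  "open \<Omega> \<Longrightarrow> u \<in> H1 \<Omega> \<Longrightarrow> has_weak_partial \<Omega> i u (weak_partial \<Omega> i u)"
  using weak_partial_eq by (fastforce simp: H1_def)

lemma weak_partial_linear:
  assumes "open \<Omega>" "u \<in> H1 \<Omega>" "v \<in> H1 \<Omega>"
  shows "weak_partial \<Omega> i (c *\<^sub>R u + d *\<^sub>R v) = c *\<^sub>R weak_partial \<Omega> i u + d *\<^sub>R weak_partial \<Omega> i v"
  using assms by (intro weak_partial_eq has_weak_partial_linear has_weak_partial_weak_partial) auto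

lemma H1_linear:
  assumes "open \<Omega>" "u \<in> H1 \<Omega>" "v \<in> H1 \<Omega>"
  shows "c *\<^sub>R u + d *\<^sub>R v \<in> H1 \<Omega>"
proof -
  have "c *\<^sub>R u + d *\<^sub>R v \<in> L2_space \<Omega>"
    using assms by (auto simp: H1_def
        intro!: subspace_add[OF subspace_L2_space] subspace_scale[OF subspace_L2_space])
  moreover have "has_weak_partial \<Omega> i (c *\<^sub>R u + d *\<^sub>R v)
      (c *\<^sub>R weak_partial \<Omega> i u + d *\<^sub>R weak_partial \<Omega> i v)" for i
    using assms by (intro has_weak_partial_linear has_weak_partial_weak_partial) auto
  ultimately show ?thesis by (auto simp: H1_def)
qed

lemma H1_diff: "open \<Omega> \<Longrightarrow> u \<in> H1 \<Omega> \<Longrightarrow> v \<in> H1 \<Omega> \<Longrightarrow> u - v \<in> H1 \<Omega>"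
  using H1_linear[of \<Omega> u v 1 "-1"] by simp

text \<open>Needed for arbitrary \<open>u\<close>, because \<^locale>\<open>Metric_space\<close> demands symmetry of the
  distance also outside the carrier. There \<^const>\<open>weak_partial\<close> is \<open>THE\<close> of an empty predicate.\<close>

lemma H1_norm_minus:
  assumes "open \<Omega>"
  shows "H1_norm \<Omega> (- u) = H1_norm \<Omega> u"
proof -
  have neg: "has_weak_partial \<Omega> i (- v) (- w)" if "has_weak_partial \<Omega> i v w" for i v w
    using has_weak_partial_linear[OF _ that that, of "-1" 0] assms by simp
  have "norm (weak_partial \<Omega> i (- u)) = norm (weak_partial \<Omega> i u)" for i
  proof (cases "\<exists>w. has_weak_partial \<Omega> i u w")
    case True
    then show ?thesis
      using neg weak_partial_eq[OF assms] by (metis norm_minus_cancel)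
  next
    case False
    \<comment> \<open>Both predicates are empty, hence equal, and \<open>THE\<close> picks the same
      value for both.\<close>
    then have "has_weak_partial \<Omega> i (- u) = has_weak_partial \<Omega> i u"
      using neg[of i "- u"] by (auto simp: fun_eq_iff)
    then show ?thesis by (simp add: weak_partial_def)
  qed
  then show ?thesis by (simp add: H1_norm_def)
qed

section \<open>The isometric embedding of \<open>H1\<close> into an inner product space\<close>

definition jet :: "(real^'n) set \<Rightarrow> (real^'n) l2 \<Rightarrow> (real^'n) l2 \<times> ((real^'n) l2 ^ 'n)" where
  "jet \<Omega> u = (u, \<chi> i. weak_partial \<Omega> i u)"

lemma jet_linear:
  "open \<Omega> \<Longrightarrow> u \<in> H1 \<Omega> \<Longrightarrow> v \<in> H1 \<Omega> \<Longrightarrow> jet \<Omega> (c *\<^sub>R u + d *\<^sub>R v) = c *\<^sub>R jet \<Omega> u + d *\<^sub>R jet \<Omega> v"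
  by (simp add: jet_def weak_partial_linear vec_eq_iff)

lemma jet_diff: "open \<Omega> \<Longrightarrow> u \<in> H1 \<Omega> \<Longrightarrow> v \<in> H1 \<Omega> \<Longrightarrow> jet \<Omega> (u - v) = jet \<Omega> u - jet \<Omega> v"
  using jet_linear[of \<Omega> u v 1 "-1"] by simp

lemma jet_inject: "jet \<Omega> u = jet \<Omega> v \<longleftrightarrow> u = v"
  by (auto simp: jet_def)

text \<open>The Euclidean norms of pairs and vectors combine to the Sobolev norm, so facts about
  normed spaces as types can be used for the set \<open>H1 \<Omega>\<close>.\<close>

lemma norm_jet: "norm (jet \<Omega> u) = H1_norm \<Omega> u"
  by (simp add: jet_def norm_Pair H1_norm_def norm_vec_def L2_set_def sum_nonneg)

lemma H1_norm_diff:
  "open \<Omega> \<Longrightarrow> u \<in> H1 \<Omega> \<Longrightarrow> v \<in> H1 \<Omega> \<Longrightarrow> H1_norm \<Omega> (u - v) = dist (jet \<Omega> u) (jet \<Omega> v)"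
  by (simp add: norm_jet[symmetric] jet_diff dist_norm)

lemma Metric_space_H1:
  fixes \<Omega> :: "(real^'n) set"
  assumes "open \<Omega>"
  shows "Metric_space (H1 \<Omega>) (\<lambda>u v. H1_norm \<Omega> (u - v))"
proof
  fix u v w :: "(real^'n) l2"
  show "0 \<le> H1_norm \<Omega> (u - v)" by (simp add: norm_jet[symmetric])
  show "H1_norm \<Omega> (u - v) = H1_norm \<Omega> (v - u)"
    using H1_norm_minus[OF assms, of "u - v"] by simp
  assume "u \<in> H1 \<Omega>" "v \<in> H1 \<Omega>"
  then show "H1_norm \<Omega> (u - v) = 0 \<longleftrightarrow> u = v"
    using assms by (simp add: H1_norm_diff jet_inject)
  assume "w \<in> H1 \<Omega>"
  with \<open>u \<in> H1 \<Omega>\<close> \<open>v \<in> H1 \<Omega>\<close> show "H1_norm \<Omega> (u - w) \<le> H1_norm \<Omega> (u - v) + H1_norm \<Omega> (v - w)"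
    using assms by (simp add: H1_norm_diff dist_triangle)
qed

text \<open>The bilinear form of the operator in terms of jets. It is also defined at pairs that are
  not jets of any function, so boundedness and continuity can be shown on the whole product
  space.\<close>

definition jet_form ::
    "real^'n \<Rightarrow> real \<Rightarrow> (real^'n) l2 \<times> ((real^'n) l2 ^ 'n)
      \<Rightarrow> (real^'n) l2 \<times> ((real^'n) l2 ^ 'n) \<Rightarrow> real"
  where
  "jet_form b k p q = snd p \<bullet> snd q + (\<Sum>i\<in>UNIV. b $ i * (snd p $ i \<bullet> fst q)) + k * (fst p \<bullet> fst q)"

lemma bounded_linear_jet_form: "bounded_linear (jet_form b k p)"
  unfolding jet_form_def
  by (intro bounded_linear_add bounded_linear_sum bounded_linear_const_mult
      bounded_linear_inner_right_comp bounded_linear_fst bounded_linear_snd)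

lemma continuous_on_jet_form [continuous_intros]:
  "continuous_on S F \<Longrightarrow> continuous_on S G \<Longrightarrow> continuous_on S (\<lambda>x. jet_form b k (F x) (G x))"
  unfolding jet_form_def by (intro continuous_intros)

lemma A_op_eq_jet_form:
  fixes \<Omega> :: "(real^'n) set"
  assumes "open \<Omega>" "u \<in> H1 \<Omega>" "w \<in> H1 \<Omega>"
  shows "A_op \<Omega> b k u w = jet_form b k (jet \<Omega> u) (jet \<Omega> w)"
proof -
  have [simp]: "\<Omega> \<in> sets lebesgue" using assms(1) by auto
  have w: "w \<in> L2_space \<Omega>" "weak_partial \<Omega> i w \<in> L2_space \<Omega>" for i
    using has_weak_partial_weak_partial[OF assms(1,3)] assms(3)
    by (auto simp: H1_def has_weak_partial_def)
  have int: "set_integrable lebesgue \<Omega> (\<lambda>x. c * (rep_l2 v x * rep_l2 z x))" for c v z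
    by (intro set_integrable_mult_right set_integrable_rep_rep) simp
  have sum: "set_integrable lebesgue \<Omega> (\<lambda>x. \<Sum>i\<in>UNIV. F i x)"
    "(LINT x:\<Omega>|lebesgue. \<Sum>i\<in>UNIV. F i x) = (\<Sum>i\<in>UNIV. LINT x:\<Omega>|lebesgue. F i x)"
    if "\<And>i. set_integrable lebesgue \<Omega> (F i)" for F :: "'n \<Rightarrow> real^'n \<Rightarrow> real"
    using that unfolding set_integrable_def set_lebesgue_integral_def
    by (simp_all only: scaleR_sum_right Bochner_Integration.integral_sum
        Bochner_Integration.integrable_sum)
  \<comment> \<open>Reassociated so that each summand is a constant times a product of two
    representatives, whose integrability is known.\<close>
  have "A_op \<Omega> b k u w = (LINT x:\<Omega>|lebesgue.
      (\<Sum>i\<in>UNIV. rep_l2 (weak_partial \<Omega> i u) x * rep_l2 (weak_partial \<Omega> i w) x)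
     + (\<Sum>i\<in>UNIV. b $ i * (rep_l2 (weak_partial \<Omega> i u) x * rep_l2 w x))
     + k * (rep_l2 u x * rep_l2 w x))"
    by (simp add: A_op_def mult.assoc)
  also have "\<dots> = (\<Sum>i\<in>UNIV. weak_partial \<Omega> i u \<bullet> weak_partial \<Omega> i w)
     + (\<Sum>i\<in>UNIV. b $ i * (weak_partial \<Omega> i u \<bullet> w)) + k * (u \<bullet> w)"
    by (simp only: set_integral_add sum int set_integrable_rep_rep set_integral_mult_right
        set_integral_rep_rep w \<open>\<Omega> \<in> sets lebesgue\<close>)
  also have "\<dots> = jet_form b k (jet \<Omega> u) (jet \<Omega> w)"
    by (simp add: jet_form_def jet_def inner_vec_def)
  finally show ?thesis .
qed

lemma L2_functional_eq_inner:
  assumes "open \<Omega>" "w \<in> H1 \<Omega>"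
  shows "L2_functional \<Omega> f w = f \<bullet> fst (jet \<Omega> w)"
  using assms by (simp add: L2_functional_def set_integral_rep_rep H1_def jet_def)

section \<open>The gap function\<close>

definition gap_term ::
    "(real^'n) set \<Rightarrow> real^'n \<Rightarrow> real \<Rightarrow> (real^'n) l2 \<Rightarrow> real \<Rightarrow> (real^'n) l2 \<Rightarrow> (real^'n) l2 \<Rightarrow> real"
  where
  "gap_term \<Omega> b k f \<gamma> v u =
     A_op \<Omega> b k u (u - v) - L2_functional \<Omega> f (u - v) - 1 / (2 * \<gamma>) * (H1_norm \<Omega> (u - v))\<^sup>2"

lemma gap_function_eq_SUP: "gap_function \<Omega> b k f C \<gamma> u = (SUP v\<in>C. ereal (gap_term \<Omega> b k f \<gamma> v u))"
  by (simp add: gap_function_def gap_term_def)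

text \<open>The point where the operator is evaluated is kept apart from the difference it acts on,
  because comparing two solutions pairs the operator at \<open>u'\<close> with
  \<open>u - u'\<close>.\<close>

lemma VI_form_eq:
  assumes "open \<Omega>" "u \<in> H1 \<Omega>" "v \<in> H1 \<Omega>" "w \<in> H1 \<Omega>"
  shows "A_op \<Omega> b k u (v - w) - L2_functional \<Omega> f (v - w)
    = jet_form b k (jet \<Omega> u) (jet \<Omega> v - jet \<Omega> w) - f \<bullet> fst (jet \<Omega> v - jet \<Omega> w)"
  using assms by (simp add: A_op_eq_jet_form L2_functional_eq_inner H1_diff jet_diff)

lemma gap_term_eq:
  assumes "open \<Omega>" "u \<in> H1 \<Omega>" "v \<in> H1 \<Omega>"
  shows "gap_term \<Omega> b k f \<gamma> v u = jet_form b k (jet \<Omega> u) (jet \<Omega> u - jet \<Omega> v)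
     - f \<bullet> fst (jet \<Omega> u - jet \<Omega> v) - 1 / (2 * \<gamma>) * (norm (jet \<Omega> u - jet \<Omega> v))\<^sup>2"
  using assms by (simp add: gap_term_def VI_form_eq H1_norm_diff dist_norm)

lemma bounded_linear_VI_form: "bounded_linear (\<lambda>q. jet_form b k p q - f \<bullet> fst q)"
  by (intro bounded_linear_sub bounded_linear_jet_form bounded_linear_inner_right_comp bounded_linear_fst)

text \<open>Completing the square: if \<open>M\<close> bounds the functional, the expression is at
  most \<open>\<gamma> * M\<^sup>2 / 2\<close>.\<close>

lemma linear_minus_quadratic_bounded_above:
  fixes L :: "'a::real_normed_vector \<Rightarrow> real"
  assumes "bounded_linear L" "0 < \<gamma>"
  obtains B where "\<And>q. L q - 1 / (2 * \<gamma>) * (norm q)\<^sup>2 \<le> B"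
proof -
  obtain M where M: "\<And>q. norm (L q) \<le> norm q * M"
    using bounded_linear.bounded[OF assms(1)] by blast
  have "L q - 1 / (2 * \<gamma>) * (norm q)\<^sup>2 \<le> \<gamma> * M\<^sup>2 / 2" for q
  proof -
    have "0 \<le> (norm q - \<gamma> * M)\<^sup>2 / (2 * \<gamma>)" using assms(2) by simp
    also have "\<dots> = 1 / (2 * \<gamma>) * (norm q)\<^sup>2 - norm q * M + \<gamma> * M\<^sup>2 / 2"
      using assms(2) by (simp add: power2_diff power2_eq_square field_simps)
    finally show ?thesis using M[of q] by simp
  qed
  then show thesis using that by blast
qed

text \<open>Division by \<open>t\<close> leaves \<open>a \<le> c * t\<close>, and \<open>t\<close>
  tends to 0 from the right.\<close>

lemma nonpos_if_le_scaled:
  fixes a c :: real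
  assumes "\<And>t. 0 < t \<Longrightarrow> t \<le> 1 \<Longrightarrow> t * a \<le> c * t\<^sup>2"
  shows "a \<le> 0"
proof (rule tendsto_lowerbound)
  show "((\<lambda>t. c * t) \<longlongrightarrow> 0) (at_right 0)"
    by (rule tendsto_eq_intros refl)+ simp
  have "a \<le> c * t" if "0 < t" "t < 1" for t
  proof -
    have "t * a \<le> t * (c * t)"
      using assms[of t] that by (simp add: power2_eq_square mult.left_commute)
    with \<open>0 < t\<close> show ?thesis by (simp only: mult_le_cancel_left_pos)
  qed
  then show "\<forall>\<^sub>F t in at_right 0. a \<le> c * t"
    unfolding eventually_at_right_field using zero_less_one by blast
qed simp

section \<open>Continuity of the gap terms and properties of their supremum\<close>

lemma openin_H1_vimage_jet:
  assumes "open \<Omega>" "open U"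
  shows "openin (H1_topology \<Omega>) {u \<in> H1 \<Omega>. jet \<Omega> u \<in> U}"
proof -
  interpret M: Metric_space "H1 \<Omega>" "\<lambda>u v. H1_norm \<Omega> (u - v)"
    by (rule Metric_space_H1[OF assms(1)])
  show ?thesis
    unfolding H1_topology_def M.openin_mtopology
  proof (intro conjI allI impI)
    fix u assume "u \<in> {u \<in> H1 \<Omega>. jet \<Omega> u \<in> U}"
    then obtain r where "0 < r" "ball (jet \<Omega> u) r \<subseteq> U"
      using assms(2) openE by blast
    have "M.mball u r \<subseteq> {u \<in> H1 \<Omega>. jet \<Omega> u \<in> U}"
    proof
      fix v assume "v \<in> M.mball u r"
      then have "v \<in> H1 \<Omega>" "jet \<Omega> v \<in> ball (jet \<Omega> u) r"
        using assms(1) by (auto simp: H1_norm_diff)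
      with \<open>ball (jet \<Omega> u) r \<subseteq> U\<close> show "v \<in> {u \<in> H1 \<Omega>. jet \<Omega> u \<in> U}" by blast
    qed
    with \<open>0 < r\<close> show "\<exists>r>0. M.mball u r \<subseteq> {u \<in> H1 \<Omega>. jet \<Omega> u \<in> U}" by blast
  qed auto
qed

lemma topspace_H1: "open \<Omega> \<Longrightarrow> topspace (H1_topology \<Omega>) = H1 \<Omega>"
  unfolding H1_topology_def by (rule Metric_space.topspace_mtopology[OF Metric_space_H1])

lemma openin_gap_term_greater:
  assumes "open \<Omega>" "v \<in> H1 \<Omega>"
  shows "openin (H1_topology \<Omega>) {u \<in> H1 \<Omega>. a < ereal (gap_term \<Omega> b k f \<gamma> v u)}"
proof -
  \<comment> \<open>The gap term as a function of the jet of \<open>u\<close>, extended to the whole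
    product space, where its continuity is evident.\<close>
  define \<Phi> where "\<Phi> p = jet_form b k p (p - jet \<Omega> v) - f \<bullet> fst (p - jet \<Omega> v)
      - 1 / (2 * \<gamma>) * (norm (p - jet \<Omega> v))\<^sup>2" for p
  have "continuous_on UNIV (\<lambda>p. ereal (\<Phi> p))"
    unfolding \<Phi>_def by (intro continuous_intros)
  then have "open {p. a < ereal (\<Phi> p)}"
    by (intro open_Collect_less continuous_on_const)
  from openin_H1_vimage_jet[OF assms(1) this] show ?thesis
    using assms by (simp add: \<Phi>_def gap_term_eq cong: conj_cong)
qed

text \<open>For fixed \<open>u\<close> the gap term depends on \<open>v\<close> only through the
  difference of the jets, as a bounded linear functional minus a quadratic. This bounds it above
  uniformly in \<open>v\<close>; any single \<open>v\<close> gives a lower bound.\<close>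

lemma gap_function_finite:
  assumes "open \<Omega>" "u \<in> H1 \<Omega>" "C \<subseteq> H1 \<Omega>" "C \<noteq> {}" "0 < \<gamma>"
  shows "\<bar>gap_function \<Omega> b k f C \<gamma> u\<bar> \<noteq> \<infinity>"
proof -
  obtain B where B: "\<And>q. jet_form b k (jet \<Omega> u) q - f \<bullet> fst q - 1 / (2 * \<gamma>) * (norm q)\<^sup>2 \<le> B"
    using linear_minus_quadratic_bounded_above[OF bounded_linear_VI_form assms(5)] by blast
  have "gap_term \<Omega> b k f \<gamma> v u \<le> B" if "v \<in> C" for v
    using that assms(3) B by (subst gap_term_eq[OF assms(1,2)]) blast+
  then have "gap_function \<Omega> b k f C \<gamma> u \<le> ereal B"
    unfolding gap_function_eq_SUP by (intro SUP_least) simp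
  moreover obtain v where "v \<in> C" using assms by blast
  then have "ereal (gap_term \<Omega> b k f \<gamma> v u) \<le> gap_function \<Omega> b k f C \<gamma> u"
    unfolding gap_function_eq_SUP by (rule SUP_upper)
  ultimately show ?thesis by auto
qed

lemma gap_function_nonneg:
  assumes "open \<Omega>" "u \<in> H1 \<Omega>" "u \<in> C"
  shows "0 \<le> gap_function \<Omega> b k f C \<gamma> u"
proof -
  have "gap_term \<Omega> b k f \<gamma> u u = 0"
    using assms linear_0[OF bounded_linear.linear[OF bounded_linear_jet_form]]
    by (simp add: gap_term_eq)
  then show ?thesis
    unfolding gap_function_eq_SUP by (intro SUP_upper2[OF assms(3)]) simp
qed

lemma gap_function_eq_0_iff:
  assumes \<Omega>: "open \<Omega>" and C: "C \<subseteq> H1 \<Omega>" "convex C" and u: "u \<in> C" and "0 < \<gamma>"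
  shows "gap_function \<Omega> b k f C \<gamma> u = 0 \<longleftrightarrow> solves_VI \<Omega> b k f C u"
proof
  assume "gap_function \<Omega> b k f C \<gamma> u = 0"
  then have le: "gap_term \<Omega> b k f \<gamma> v u \<le> 0" if "v \<in> C" for v
    using SUP_upper[OF that, of "\<lambda>v. ereal (gap_term \<Omega> b k f \<gamma> v u)"] by (simp add: gap_function_eq_SUP)
  have "A_op \<Omega> b k u (u - v) - L2_functional \<Omega> f (u - v) \<le> 0" if v: "v \<in> C" for v
  proof (rule nonpos_if_le_scaled)
    fix t :: real assume t: "0 < t" "t \<le> 1"
    define w where "w = (1 - t) *\<^sub>R u + t *\<^sub>R v"
    have "w \<in> C"
      unfolding w_def using C(2) u v t by (intro convexD) auto
    have uv: "u \<in> H1 \<Omega>" "v \<in> H1 \<Omega>" "w \<in> H1 \<Omega>" using C u v \<open>w \<in> C\<close> by auto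
    \<comment> \<open>Towards \<open>w\<close> the linear part scales with \<open>t\<close>, the
      quadratic part with its square.\<close>
    have q: "jet \<Omega> u - jet \<Omega> w = t *\<^sub>R (jet \<Omega> u - jet \<Omega> v)"
      unfolding w_def jet_linear[OF \<Omega> uv(1,2)] by (simp add: algebra_simps)
    have "t * (A_op \<Omega> b k u (u - v) - L2_functional \<Omega> f (u - v))
        = jet_form b k (jet \<Omega> u) (jet \<Omega> u - jet \<Omega> w) - f \<bullet> fst (jet \<Omega> u - jet \<Omega> w)"
      unfolding q VI_form_eq[OF \<Omega> uv(1,1,2)]
      by (simp add: linear_scale[OF bounded_linear.linear[OF bounded_linear_jet_form]]
          right_diff_distrib scaleR_diff_right[symmetric])
    also have "\<dots> \<le> 1 / (2 * \<gamma>) * (norm (jet \<Omega> u - jet \<Omega> w))\<^sup>2"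
      using le[OF \<open>w \<in> C\<close>] \<Omega> uv by (simp add: gap_term_eq)
    also have "\<dots> = 1 / (2 * \<gamma>) * (norm (jet \<Omega> u - jet \<Omega> v))\<^sup>2 * t\<^sup>2"
      unfolding q by (simp add: power_mult_distrib)
    finally show "t * (A_op \<Omega> b k u (u - v) - L2_functional \<Omega> f (u - v)) \<le> \<dots>" .
  qed
  then show "solves_VI \<Omega> b k f C u"
    using u by (simp add: solves_VI_def)
next
  assume VI: "solves_VI \<Omega> b k f C u"
  \<comment> \<open>Here the nonnegative quadratic term is simply dropped.\<close>
  have "gap_term \<Omega> b k f \<gamma> v u \<le> 0" if "v \<in> C" for v
  proof -
    have "A_op \<Omega> b k u (u - v) - L2_functional \<Omega> f (u - v) \<le> 0"
      using VI that by (simp add: solves_VI_def)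
    moreover have "0 \<le> 1 / (2 * \<gamma>) * (H1_norm \<Omega> (u - v))\<^sup>2"
      using \<open>0 < \<gamma>\<close> by simp
    ultimately show ?thesis unfolding gap_term_def by linarith
  qed
  then have "gap_function \<Omega> b k f C \<gamma> u \<le> 0"
    unfolding gap_function_eq_SUP by (intro SUP_least) simp
  moreover have "0 \<le> gap_function \<Omega> b k f C \<gamma> u"
    using \<Omega> C u by (intro gap_function_nonneg) auto
  ultimately show "gap_function \<Omega> b k f C \<gamma> u = 0" by (rule antisym)
qed

text \<open>A strict superlevel set of a supremum is the union of those of its members, each of
  which is open by continuity of the gap term.\<close>

lemma lower_semicontinuous_gap_function:
  assumes "open \<Omega>" "C \<subseteq> H1 \<Omega>"
  shows "lower_semicontinuous_map (subtopology (H1_topology \<Omega>) S) (gap_function \<Omega> b k f C \<gamma>)"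
  unfolding lower_semicontinuous_map_def
proof
  fix a :: ereal
  have "openin (H1_topology \<Omega>) (\<Union>v\<in>C. {u \<in> H1 \<Omega>. a < ereal (gap_term \<Omega> b k f \<gamma> v u)})"
    using openin_gap_term_greater[OF assms(1)] assms(2) by (intro openin_Union) blast
  moreover have "{u \<in> topspace (subtopology (H1_topology \<Omega>) S). a < gap_function \<Omega> b k f C \<gamma> u}
      = (\<Union>v\<in>C. {u \<in> H1 \<Omega>. a < ereal (gap_term \<Omega> b k f \<gamma> v u)}) \<inter> S"
    using assms by (auto simp: topspace_H1 gap_function_eq_SUP less_SUP_iff)
  ultimately show "openin (subtopology (H1_topology \<Omega>) S)
      {u \<in> topspace (subtopology (H1_topology \<Omega>) S). a < gap_function \<Omega> b k f C \<gamma> u}"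
    unfolding openin_subtopology by blast
qed

text \<open>Testing the inequality for \<open>u\<close> with \<open>u'\<close> and vice versa, strong monotonicity forces
  \<open>u = u'\<close>.\<close>

lemma solves_VI_subset_iff:
  assumes \<Omega>: "open \<Omega>" and K: "K \<subseteq> H1 \<Omega>" and "0 < Ca"
    and mono: "\<forall>u\<in>K. \<forall>v\<in>K. Ca * (H1_norm \<Omega> (u - v))\<^sup>2 \<le> A_op \<Omega> b k u (u - v) - A_op \<Omega> b k v (u - v)"
    and sol: "solves_VI \<Omega> b k f K u'" and C: "C \<subseteq> K" "u' \<in> C" and u: "u \<in> C"
  shows "solves_VI \<Omega> b k f C u \<longleftrightarrow> solves_VI \<Omega> b k f K u"
proof
  assume VI: "solves_VI \<Omega> b k f C u"
  have H1: "u \<in> H1 \<Omega>" "u' \<in> H1 \<Omega>" and uK: "u \<in> K" "u' \<in> K" using C u K by auto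
  have "A_op \<Omega> b k u (u - u') - L2_functional \<Omega> f (u - u') \<le> 0"
    using VI C by (simp add: solves_VI_def)
  moreover have "A_op \<Omega> b k u' (u' - u) - L2_functional \<Omega> f (u' - u) \<le> 0"
    using sol uK by (simp add: solves_VI_def)
  \<comment> \<open>Linearity reverses the sign, so both inequalities concern \<open>u - u'\<close>
    and the contribution of \<open>f\<close> cancels when they are added.\<close>
  moreover have "A_op \<Omega> b k u' (u' - u) - L2_functional \<Omega> f (u' - u)
      = - (A_op \<Omega> b k u' (u - u') - L2_functional \<Omega> f (u - u'))"
    using linear_neg[OF bounded_linear.linear[OF bounded_linear_VI_form],
        of b k "jet \<Omega> u'" "jet \<Omega> u - jet \<Omega> u'" f] \<Omega> H1
    by (simp only: VI_form_eq minus_diff_eq)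
  ultimately have "A_op \<Omega> b k u (u - u') - A_op \<Omega> b k u' (u - u') \<le> 0" by linarith
  with mono uK have "Ca * (H1_norm \<Omega> (u - u'))\<^sup>2 \<le> 0" by fastforce
  with \<open>0 < Ca\<close> have "H1_norm \<Omega> (u - u') = 0" by (simp add: mult_le_0_iff)
  then have "u = u'" using \<Omega> H1 by (simp add: H1_norm_diff jet_inject)
  with sol show "solves_VI \<Omega> b k f K u" by simp
next
  assume "solves_VI \<Omega> b k f K u"
  with C u show "solves_VI \<Omega> b k f C u" by (auto simp: solves_VI_def)
qed

theorem lemma6:
  fixes \<Omega> :: "(real^'n) set" and f \<psi> ustar :: "(real^'n) l2" and h :: "real^'n \<Rightarrow> real"
    and b :: "real^'n" and k Ca Cb \<gamma> :: real and K X Y :: "(real^'n) l2 set"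
    and G :: "(real^'n) l2 \<Rightarrow> ereal"
  assumes "bounded_lipschitz_domain \<Omega>"
    and "f \<in> L2_space \<Omega>" and "h \<in> H_half \<Omega>" and "\<psi> \<in> H1 \<Omega>"
    and "\<exists>g. has_trace \<Omega> \<psi> g \<and> (AE x in surface_measure \<Omega>. g x \<le> h x)"
    and K: "K = obstacle_set \<Omega> \<psi> h"
    and "\<forall>i. 0 \<le> b $ i" and "0 \<le> k" and "0 < Ca" and "0 < Cb"
    and "\<forall>u\<in>K. \<forall>v\<in>K. dual_norm \<Omega> (\<lambda>w. A_op \<Omega> b k u w - A_op \<Omega> b k v w) \<le> Cb * H1_norm \<Omega> (u - v)"
    and "\<forall>u\<in>K. \<forall>v\<in>K. Ca * (H1_norm \<Omega> (u - v))\<^sup>2 \<le> A_op \<Omega> b k u (u - v) - A_op \<Omega> b k v (u - v)"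
    and "solves_VI \<Omega> b k f K ustar"
    and "ustar \<in> X \<inter> Y"
    and "K \<inter> X \<subseteq> K \<inter> Y"
    and "convex (K \<inter> Y)" and "closedin (H1_topology \<Omega>) (K \<inter> Y)"
    and "0 < \<gamma>"
    and G: "G = gap_function \<Omega> b k f (K \<inter> Y) \<gamma>"
  shows "(\<forall>u\<in>H1 \<Omega>. \<bar>G u\<bar> \<noteq> \<infinity>)
    \<and> (\<forall>u\<in>K \<inter> X. 0 \<le> G u)
    \<and> (\<forall>u\<in>K \<inter> X. G u = 0 \<longleftrightarrow> solves_VI \<Omega> b k f K u)
    \<and> lower_semicontinuous_map (subtopology (H1_topology \<Omega>) (K \<inter> X)) G"
proof -
  have \<Omega>: "open \<Omega>" using assms(1) by (simp add: bounded_lipschitz_domain_def)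
  have KH: "K \<subseteq> H1 \<Omega>" by (auto simp: K obstacle_set_def)
  \<comment> \<open>This point makes the supremum range over a nonempty set and serves as the
    competitor when passing from \<open>K \<inter> Y\<close> back to \<open>K\<close>.\<close>
  have ustar: "ustar \<in> K \<inter> Y" using assms(13,14) by (auto simp: solves_VI_def)
  \<comment> \<open>Makes the choice \<open>v = u\<close> admissible in the supremum.\<close>
  have XY: "u \<in> K \<inter> Y" if "u \<in> K \<inter> X" for u using that assms(15) by blast
  have "\<bar>G u\<bar> \<noteq> \<infinity>" if "u \<in> H1 \<Omega>" for u
    unfolding G using that KH ustar \<open>0 < \<gamma>\<close> by (intro gap_function_finite \<Omega>) auto
  moreover have "0 \<le> G u" if "u \<in> K \<inter> X" for u
    unfolding G using KH XY[OF that] by (intro gap_function_nonneg \<Omega>) auto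
  moreover have "G u = 0 \<longleftrightarrow> solves_VI \<Omega> b k f K u" if "u \<in> K \<inter> X" for u
  proof -
    have "G u = 0 \<longleftrightarrow> solves_VI \<Omega> b k f (K \<inter> Y) u"
      unfolding G using KH XY[OF that] \<open>convex (K \<inter> Y)\<close> \<open>0 < \<gamma>\<close>
      by (intro gap_function_eq_0_iff \<Omega>) auto
    also have "\<dots> \<longleftrightarrow> solves_VI \<Omega> b k f K u"
      using solves_VI_subset_iff[OF \<Omega> KH \<open>0 < Ca\<close> assms(12,13) _ ustar XY[OF that]] by blast
    finally show ?thesis .
  qed
  moreover have "lower_semicontinuous_map (subtopology (H1_topology \<Omega>) (K \<inter> X)) G"
    unfolding G using KH by (intro lower_semicontinuous_gap_function \<Omega>) auto
  ultimately show ?thesis by auto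
qed

end
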